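(* Let $D$ be an integral domain. The space $\mathrm{LS}_f(D)$ of the localizing systems of finite type on $D$, endowed with the Zariski topology induced by $\mathrm{LS}(D)$, is a spectral space.
   Context: A localizing system on $D$ is a nonempty set $\mathcal F$ of nonzero ideals of $D$ such that: (i) if $I\in\mathcal F$ and $J$ is an ideal of $D$ with $I\subseteq J$, then $J\in\mathcal F$; (ii) if $I\in\mathcal F$ and $J$ is an ideal of $D$ such that $(J:_D iD):=\{d\in D\mid di\in J\}\in\mathcal F$ for each $i\in I$, then $J\in\mathcal F$. It is of finite type if for each $I\in\mathcal F$ there is a nonzero finitely generated ideal $J\in\mathcal F$ with $J\subseteq I$. $\mathrm{LS}(D)$ (resp. $\mathrm{LS}_f(D)$) is the set of localizing systems (resp. localizing systems of finite type) on $D$. The Zariski topology on $\mathrm{LS}(D)$ has as subbasic open sets the sets $W_I:=\{\mathcal F\in\mathrm{LS}(D)\mid I\in\mathcal F\}$, as $I$ varies among the ideals of $D$. A spectral space is a topological space homeomorphic to the prime spectrum of a commutative ring with the Zariski topology. *)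

theory Defs
  imports "HOL-Analysis.Analysis" "HOL-Algebra.Ideal"
begin

definition prime_spectrum :: "('r, 's) ring_scheme \<Rightarrow> 'r set set"
  where "prime_spectrum R = {P. primeideal P R}"

(* The Zariski closed sets are the V(S) = {P. S \<subseteq> P}; the complements of V({f}),
   for f in R, form the usual basis. *)
definition prime_spectrum_topology :: "('r, 's) ring_scheme \<Rightarrow> 'r set topology"
  where "prime_spectrum_topology R =
    topology_generated_by {{P \<in> prime_spectrum R. f \<notin> P} | f. f \<in> carrier R}"

lemma topspace_prime_spectrum_topology:
  "topspace (prime_spectrum_topology R) = prime_spectrum R"
proof -
  have "\<exists>f\<in>carrier R. f \<notin> P" if "primeideal P R" for P
  proof -
    interpret primeideal P R by fact
    show ?thesis using I_notcarr a_subset by blast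
  qed
  then show ?thesis
    unfolding prime_spectrum_topology_def prime_spectrum_def topology_generated_by_topspace
    by blast
qed

(* HOL cannot quantify over types inside a formula, so the ring in the definition of a
   spectral space needs a fixed carrier type. The type ('p + nat) set has cardinality
   2 ^ max |'p| aleph_0, and this loses no spectral space with points in 'p. Such a space X
   has at most 2 ^ |'p| quasi-compact open sets, and Hochster's construction realises X as the
   spectrum of a ring generated by elements indexed by these sets, over a countable field and
   up to localization, which has at most 2 ^ max |'p| aleph_0 elements. The summand nat is
   needed because a finite spectral space (e.g. the Sierpinski space) may only be the
   spectrum of infinite rings. *)
definition spectral_space :: "'p topology \<Rightarrow> bool"
  where "spectral_space X \<longleftrightarrow>
    (\<exists>R :: ('p + nat) set ring. cring R \<and> X homeomorphic_space prime_spectrum_topology R)"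

(* (J :_D iD) *)
definition ideal_colon :: "('a, 'm) ring_scheme \<Rightarrow> 'a set \<Rightarrow> 'a \<Rightarrow> 'a set"
  where "ideal_colon D J i = {d \<in> carrier D. d \<otimes>\<^bsub>D\<^esub> i \<in> J}"

definition localizing_system :: "('a, 'm) ring_scheme \<Rightarrow> 'a set set \<Rightarrow> bool"
  where "localizing_system D \<F> \<longleftrightarrow>
    \<F> \<noteq> {} \<and>
    (\<forall>I\<in>\<F>. ideal I D \<and> I \<noteq> {\<zero>\<^bsub>D\<^esub>}) \<and>
    (\<forall>I J. I \<in> \<F> \<and> ideal J D \<and> I \<subseteq> J \<longrightarrow> J \<in> \<F>) \<and>
    (\<forall>I J. I \<in> \<F> \<and> ideal J D \<and> (\<forall>i\<in>I. ideal_colon D J i \<in> \<F>) \<longrightarrow> J \<in> \<F>)"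

definition fin_gen_ideal :: "('a, 'm) ring_scheme \<Rightarrow> 'a set \<Rightarrow> bool"
  where "fin_gen_ideal D J \<longleftrightarrow> (\<exists>S. finite S \<and> S \<subseteq> carrier D \<and> J = Idl\<^bsub>D\<^esub> S)"

definition finite_type :: "('a, 'm) ring_scheme \<Rightarrow> 'a set set \<Rightarrow> bool"
  where "finite_type D \<F> \<longleftrightarrow>
    (\<forall>I\<in>\<F>. \<exists>J\<in>\<F>. fin_gen_ideal D J \<and> J \<noteq> {\<zero>\<^bsub>D\<^esub>} \<and> J \<subseteq> I)"

definition LS :: "('a, 'm) ring_scheme \<Rightarrow> 'a set set set"
  where "LS D = {\<F>. localizing_system D \<F>}"

definition LS_f :: "('a, 'm) ring_scheme \<Rightarrow> 'a set set set"
  where "LS_f D = {\<F> \<in> LS D. finite_type D \<F>}"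

definition LS_zariski :: "('a, 'm) ring_scheme \<Rightarrow> 'a set set topology"
  where "LS_zariski D = topology_generated_by {{\<F> \<in> LS D. I \<in> \<F>} | I. ideal I D}"

lemma topspace_LS_zariski: "topspace (LS_zariski D) = LS D"
proof -
  have "\<exists>I. ideal I D \<and> I \<in> \<F>" if "\<F> \<in> LS D" for \<F>
    using that unfolding LS_def localizing_system_def by blast
  then show ?thesis
    unfolding LS_zariski_def topology_generated_by_topspace by blast
qed

end

theory Submission
  imports Defs "HOL-Algebra.Weak_Morphisms" "HOL-Algebra.Free_Abelian_Groups"
    "HOL-Library.Poly_Mapping" "HOL-Computational_Algebra.Formal_Laurent_Series"
    "HOL-Computational_Algebra.Fraction_Field"
begin

text \<open>
  A localizing system of finite type is determined by the nonzero finitely generated ideals that it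
  contains. These form a filter: they are closed under enlarging and, since \<open>(IJ : i)\<close> contains \<open>J\<close> for
  \<open>i \<in> I\<close>, under products. Conversely each filter of finitely generated ideals, with respect to a suitable
  preorder in which products are meets, generates a localizing system of finite type. So the space is
  homeomorphic to the space of filters of a preorder \<open>B\<close> with finite meets, topologized by the sets
  of filters that contain a given \<open>i \<in> B\<close> (\<open>LS_f_homeomorphic_filters\<close>), and it remains to
  realize any such space as the spectrum of a ring (\<open>spectral_space_filter_topology\<close>).

  Let \<open>K\<close> be the field of rational functions over \<open>\<int>\<close> in indeterminates \<open>t\<^sub>i\<close>. Each filter \<open>\<Phi>\<close> has a discrete
  valuation of \<open>K\<close>, the degree in the indeterminates outside \<open>\<Phi>\<close>, together with the place that sets these
  indeterminates to \<open>0\<close>. In concrete terms, \<open>K\<close> is mapped to \<open>K((z))\<close> by \<open>t\<^sub>i \<mapsto> t\<^sub>i\<close> for \<open>i \<in> \<Phi>\<close> and \<open>t\<^sub>i \<mapsto> z t\<^sub>i\<close> for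
  the other \<open>i\<close>. The ring consists of the functions \<open>f\<close> from filters to \<open>K\<close> for which \<open>f \<Phi>\<close> depends only on the
  intersection of \<open>\<Phi>\<close> with a finite set, and for which \<open>f \<Psi>\<close> specializes to \<open>f \<Phi>\<close> at \<open>\<Phi>\<close> whenever \<open>\<Phi> \<subseteq> \<Psi>\<close>. Three
  facts show that its primes are the kernels of evaluation at the filters.

    \<^item> The nonvanishing locus of \<open>f\<close> is a union of finitely many basic open sets
      (\<open>support_finite_union\<close>). The reason is that a basic open set has a least point, a principal filter.
    \<^item> Each basic open set is the nonvanishing locus of a coordinate function, with value \<open>t\<^sub>i\<close> at the filters
      that contain \<open>i\<close> and \<open>0\<close> elsewhere. A finite union of them is the locus of the sum of these functions,
      as distinct indeterminates do not cancel.
    \<^item> If \<open>g\<close> vanishes wherever \<open>f\<close> does, then \<open>f\<close> divides a power of \<open>g\<close> (\<open>divides_power\<close>): the pointwise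
      quotient of a high power of \<open>g\<close> by \<open>f\<close> is again in the ring, because the valuations are discrete and
      those of \<open>f\<close> are uniformly bounded.

  So a prime contains a function if and only if it contains all coordinate functions for its
  nonvanishing locus, and the indices of the coordinate functions outside the prime form a filter. The
  construction is in the spirit of Hochster's, but the least points make it possible to write down the
  ring in one step.
\<close>

section \<open>A field with rescalable indeterminates\<close>

text \<open>
  The monoid algebra \<open>\<int>[M]\<close> is an integral domain when the monoid \<open>M\<close> is linearly ordered, because
  leading terms multiply. To have polynomials whose indeterminates are indexed by an arbitrary type, the
  index type is copied and the copy is ordered by a well-order obtained from the axiom of choice.
  The order itself carries no meaning.
\<close>

typedef 'i ordered = "UNIV :: 'i set" morphisms unwrap wrap ..

instantiation ordered :: (type) linorder
begin

definition less_eq_ordered :: "'a ordered \<Rightarrow> 'a ordered \<Rightarrow> bool"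
  where "x \<le> (y :: 'a ordered) \<longleftrightarrow> (unwrap x, unwrap y) \<in> (SOME r. well_order_on UNIV r)"

definition less_ordered :: "'a ordered \<Rightarrow> 'a ordered \<Rightarrow> bool"
  where "x < (y :: 'a ordered) \<longleftrightarrow> x \<le> y \<and> \<not> y \<le> x"

instance
proof -
  define r :: "'a rel" where "r = (SOME r. well_order_on UNIV r)"
  have "well_order_on UNIV r"
    unfolding r_def using well_order_on[of UNIV] by (rule someI_ex)
  then have refl: "refl r" and trans: "trans r" and antisym: "antisym r" and total: "total r"
    by (auto simp: well_order_on_def linear_order_on_def partial_order_on_def preorder_on_def)
  have le: "x \<le> y \<longleftrightarrow> (unwrap x, unwrap y) \<in> r" for x y :: "'a ordered"
    by (simp add: less_eq_ordered_def r_def)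
  show "OFCLASS('a ordered, linorder_class)"
  proof
    fix x y z :: "'a ordered"
    show "(x < y) = (x \<le> y \<and> \<not> y \<le> x)" by (rule less_ordered_def)
    show "x \<le> x" using refl by (simp add: le refl_on_def)
    show "x \<le> y \<Longrightarrow> y \<le> z \<Longrightarrow> x \<le> z" unfolding le using trans by (rule transD)
    show "x \<le> y \<Longrightarrow> y \<le> x \<Longrightarrow> x = y"
      unfolding le using antisym by (metis antisymD unwrap_inject)
    show "x \<le> y \<or> y \<le> x" unfolding le using total refl by (metis UNIV_I refl_onD total_on_def)
  qed
qed

end

type_synonym 'i monomial = "'i ordered \<Rightarrow>\<^sub>0 nat"
type_synonym 'i mpoly = "'i monomial \<Rightarrow>\<^sub>0 int"
type_synonym 'i ratfun = "'i mpoly fract"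

text \<open>
  The additive extension of a map on monomials. It is a ring homomorphism as soon as the map is
  multiplicative, by the universal property of the monoid algebra.
\<close>

definition extend_linear :: "('m \<Rightarrow> 'r) \<Rightarrow> ('m::comm_monoid_add \<Rightarrow>\<^sub>0 int) \<Rightarrow> 'r::comm_ring_1"
  where "extend_linear \<phi> p = (\<Sum>m\<in>Poly_Mapping.keys p. of_int (Poly_Mapping.lookup p m) * \<phi> m)"

lemma extend_linear_superset:
  assumes "finite A" "Poly_Mapping.keys p \<subseteq> A"
  shows "extend_linear \<phi> p = (\<Sum>m\<in>A. of_int (Poly_Mapping.lookup p m) * \<phi> m)"
  unfolding extend_linear_def
  by (rule sum.mono_neutral_left) (use assms in \<open>auto simp: in_keys_iff\<close>)

lemma extend_linear_zero: "extend_linear \<phi> 0 = 0"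
  by (simp add: extend_linear_def)

lemma extend_linear_single: "extend_linear \<phi> (Poly_Mapping.single m c) = of_int c * \<phi> m"
  by (simp add: extend_linear_def)

lemma extend_linear_add: "extend_linear \<phi> (p + q) = extend_linear \<phi> p + extend_linear \<phi> q"
proof -
  let ?A = "Poly_Mapping.keys p \<union> Poly_Mapping.keys q"
  have "Poly_Mapping.keys (p + q) \<subseteq> ?A" by (rule keys_add)
  then show ?thesis
    by (simp add: extend_linear_superset[of ?A] lookup_add sum.distrib distrib_right)
qed

lemma extend_linear_sum: "extend_linear \<phi> (\<Sum>a\<in>A. f a) = (\<Sum>a\<in>A. extend_linear \<phi> (f a))"
  by (induction A rule: infinite_finite_induct) (simp_all add: extend_linear_zero extend_linear_add)

lemma poly_mapping_sum_singles:
  "(p :: 'm \<Rightarrow>\<^sub>0 'c::comm_monoid_add) = (\<Sum>m\<in>Poly_Mapping.keys p. Poly_Mapping.single m (Poly_Mapping.lookup p m))"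
  by (rule poly_mapping_eqI) (simp add: lookup_sum lookup_single when_def in_keys_iff)

lemma extend_linear_mult:
  assumes "\<And>m n. \<phi> (m + n) = \<phi> m * \<phi> n"
  shows "extend_linear \<phi> (p * q) = extend_linear \<phi> p * extend_linear \<phi> q"
proof -
  let ?l = Poly_Mapping.lookup and ?k = Poly_Mapping.keys
  have "p * q = (\<Sum>m\<in>?k p. Poly_Mapping.single m (?l p m)) * (\<Sum>n\<in>?k q. Poly_Mapping.single n (?l q n))"
    by (simp flip: poly_mapping_sum_singles)
  also have "\<dots> = (\<Sum>m\<in>?k p. \<Sum>n\<in>?k q. Poly_Mapping.single (m + n) (?l p m * ?l q n))"
    by (simp add: sum_product mult_single)
  finally have "extend_linear \<phi> (p * q) = (\<Sum>m\<in>?k p. \<Sum>n\<in>?k q. of_int (?l p m * ?l q n) * \<phi> (m + n))"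
    by (simp add: extend_linear_sum extend_linear_single)
  also have "\<dots> = extend_linear \<phi> p * extend_linear \<phi> q"
    by (simp add: extend_linear_def sum_product assms mult_ac)
  finally show ?thesis .
qed

text \<open>
  A description by choice of the map that \<open>h\<close> induces on fractions. It is meaningful if \<open>h\<close> is an
  injective ring homomorphism, which makes the value independent of the chosen fraction.
\<close>

definition extend_fract :: "('p::idom \<Rightarrow> 'k::field) \<Rightarrow> 'p fract \<Rightarrow> 'k"
  where "extend_fract h x = (SOME y. \<exists>a b. b \<noteq> 0 \<and> x = Fract a b \<and> y = h a / h b)"

locale idom_embedding =
  fixes h :: "'p::idom \<Rightarrow> 'k::field"
  assumes one: "h 1 = 1"
    and add: "h (a + b) = h a + h b"
    and mult: "h (a * b) = h a * h b"
    and nonzero: "a \<noteq> 0 \<Longrightarrow> h a \<noteq> 0"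
begin

lemma zero: "h 0 = 0"
  using add[of 0 0] by (metis add_0_right add_cancel_right_right)

lemma extend_Fract:
  assumes "b \<noteq> 0"
  shows "extend_fract h (Fract a b) = h a / h b"
proof -
  have "\<exists>y a' b'. b' \<noteq> 0 \<and> Fract a b = Fract a' b' \<and> y = h a' / h b'"
    using assms by blast
  from someI_ex[OF this] obtain a' b' where *: "b' \<noteq> 0" "Fract a b = Fract a' b'"
    "extend_fract h (Fract a b) = h a' / h b'"
    unfolding extend_fract_def by blast
  then have "a * b' = a' * b" using assms by (simp add: eq_fract)
  then have "h a * h b' = h a' * h b" by (metis mult)
  then show ?thesis using * assms nonzero by (simp add: frac_eq_eq)
qed

lemma extend_zero: "extend_fract h 0 = 0" and extend_one: "extend_fract h 1 = 1"
  by (simp_all add: Zero_fract_def One_fract_def extend_Fract one zero)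

lemma extend_add: "extend_fract h (x + y) = extend_fract h x + extend_fract h y"
  by (cases x; cases y) (simp add: extend_Fract add mult nonzero add_frac_eq mult_ac)

lemma extend_mult: "extend_fract h (x * y) = extend_fract h x * extend_fract h y"
  by (cases x; cases y) (simp add: extend_Fract mult)

lemma extend_nonzero: "x \<noteq> 0 \<Longrightarrow> extend_fract h x \<noteq> 0"
  by (cases x) (use nonzero in \<open>auto simp: extend_Fract Zero_fract_def eq_fract\<close>)

lemma extend_uminus: "extend_fract h (- x) = - extend_fract h x"
  using extend_add[of x "- x"] by (simp add: extend_zero eq_neg_iff_add_eq_0 add.commute)

lemma extend_power: "extend_fract h (x ^ n) = extend_fract h x ^ n"
  by (induction n) (simp_all add: extend_one extend_mult)

lemma extend_divide: "extend_fract h (x / y) = extend_fract h x / extend_fract h y"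
proof (cases "y = 0")
  case False
  then have "extend_fract h (x / y) * extend_fract h y = extend_fract h x"
    by (simp flip: extend_mult)
  then show ?thesis using extend_nonzero[OF False] by (simp add: field_simps)
qed (simp add: extend_zero)

end

text \<open>
  The total degree of a monomial in the indeterminates whose index lies outside \<open>\<Phi>\<close>.
\<close>

definition outer_degree :: "'i set \<Rightarrow> 'i monomial \<Rightarrow> nat"
  where "outer_degree \<Phi> m = (\<Sum>i\<in>Poly_Mapping.keys m. if unwrap i \<in> \<Phi> then 0 else Poly_Mapping.lookup m i)"

lemma outer_degree_add: "outer_degree \<Phi> (m + n) = outer_degree \<Phi> m + outer_degree \<Phi> n"
proof -
  let ?A = "Poly_Mapping.keys m \<union> Poly_Mapping.keys n"
  have *: "outer_degree \<Phi> l = (\<Sum>i\<in>?A. if unwrap i \<in> \<Phi> then 0 else Poly_Mapping.lookup l i)"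
    if "Poly_Mapping.keys l \<subseteq> ?A" for l
    unfolding outer_degree_def
    by (rule sum.mono_neutral_left) (use that in \<open>auto simp: in_keys_iff\<close>)
  show ?thesis
    using keys_add[of m n] by (auto simp: * lookup_add simp flip: sum.distrib intro!: sum.cong)
qed

lemma outer_degree_le: "outer_degree \<Phi> m \<le> outer_degree {} m"
  unfolding outer_degree_def by (rule sum_mono) simp

definition monomial_fract :: "'i monomial \<Rightarrow> 'i ratfun"
  where "monomial_fract m = Fract (Poly_Mapping.single m 1) 1"

definition scale_monomial :: "'i set \<Rightarrow> 'i monomial \<Rightarrow> 'i ratfun fls"
  where "scale_monomial \<Phi> m = fls_X ^ outer_degree \<Phi> m * fls_const (monomial_fract m)"

lemma scale_monomial_add: "scale_monomial \<Phi> (m + n) = scale_monomial \<Phi> m * scale_monomial \<Phi> n"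
proof -
  have "monomial_fract (m + n) = monomial_fract m * monomial_fract n"
    by (simp add: monomial_fract_def mult_single)
  then show ?thesis
    by (simp add: scale_monomial_def outer_degree_add power_add mult_ac
        flip: fls_const_mult_const)
qed

lemma scale_monomial_nth:
  "fls_nth (scale_monomial \<Phi> m) k = (if k = int (outer_degree \<Phi> m) then monomial_fract m else 0)"
  by (simp add: scale_monomial_def fls_X_power_times_conv_shift)

text \<open>
  The coefficient of \<open>z\<^sup>k\<close> in the rescaled polynomial is its homogeneous part of outer degree \<open>k\<close>.
\<close>

lemma extend_linear_scale_nth:
  "fls_nth (extend_linear (scale_monomial \<Phi>) p) k =
    Fract (\<Sum>m\<in>{m\<in>Poly_Mapping.keys p. int (outer_degree \<Phi> m) = k}.
             Poly_Mapping.single m (Poly_Mapping.lookup p m)) 1"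
proof -
  have of_int_monomial: "of_int c * monomial_fract m = Fract (Poly_Mapping.single m c) 1" for c and m :: "'a monomial"
  proof -
    have "(of_int c :: 'a ratfun) = Fract (of_int c) 1"
      by (cases c) (simp_all add: fract_expand flip: Fract_of_nat_eq)
    also have "(of_int c :: 'a mpoly) = Poly_Mapping.single 0 c"
      using single_of_int[of c, where 'a = "'a monomial" and 'b = int] by simp
    finally have "of_int c = Fract (Poly_Mapping.single (0 :: 'a monomial) c) 1" .
    then show ?thesis by (simp add: monomial_fract_def mult_single)
  qed
  have Fract_sum: "(\<Sum>a\<in>A. Fract (f a) 1) = Fract (\<Sum>a\<in>A. f a) 1" for A and f :: "'x \<Rightarrow> 'a mpoly"
    by (induction A rule: infinite_finite_induct) (simp_all add: Zero_fract_def)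
  show ?thesis
    unfolding extend_linear_def fls_nth_sum Fract_sum[symmetric] sum.inter_filter[OF finite_keys]
    by (rule sum.cong) (auto simp: scale_monomial_nth of_int_monomial Zero_fract_def)
qed


lemma extend_linear_scale_ge0: "0 \<le> fls_subdegree (extend_linear (scale_monomial \<Phi>) p)"
proof (rule fls_subdegree_ge0I)
  fix k :: int assume "k < 0"
  then have "{m\<in>Poly_Mapping.keys p. int (outer_degree \<Phi> m) = k} = {}" by auto
  then show "fls_nth (extend_linear (scale_monomial \<Phi>) p) k = 0"
    by (simp only: extend_linear_scale_nth sum.empty) (simp add: Zero_fract_def)
qed

lemma extend_linear_scale_nth_nonzero:
  assumes "m \<in> Poly_Mapping.keys p"
  shows "fls_nth (extend_linear (scale_monomial \<Phi>) p) (int (outer_degree \<Phi> m)) \<noteq> 0"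
proof -
  let ?q = "\<Sum>n\<in>{n\<in>Poly_Mapping.keys p. int (outer_degree \<Phi> n) = int (outer_degree \<Phi> m)}.
             Poly_Mapping.single n (Poly_Mapping.lookup p n)"
  have "Poly_Mapping.lookup ?q m = Poly_Mapping.lookup p m"
    using assms by (simp add: lookup_sum lookup_single when_def)
  then have "?q \<noteq> 0" using assms by (auto simp: in_keys_iff)
  then show ?thesis
    unfolding extend_linear_scale_nth by (simp add: Zero_fract_def eq_fract)
qed

text \<open>
  Injectivity holds because the homogeneous part that contains a given monomial of \<open>p\<close> is nonzero.
\<close>

interpretation scale: idom_embedding "extend_linear (scale_monomial \<Phi>)" for \<Phi> :: "'i set"
proof
  have "extend_linear (scale_monomial \<Phi>) (Poly_Mapping.single 0 1) = 1"
    by (simp only: extend_linear_single)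
       (simp add: scale_monomial_def outer_degree_def monomial_fract_def flip: One_fract_def)
  then show "extend_linear (scale_monomial \<Phi>) 1 = 1" by simp
next
  fix p q :: "'i mpoly"
  show "extend_linear (scale_monomial \<Phi>) (p + q) =
      extend_linear (scale_monomial \<Phi>) p + extend_linear (scale_monomial \<Phi>) q"
    by (rule extend_linear_add)
  show "extend_linear (scale_monomial \<Phi>) (p * q) =
      extend_linear (scale_monomial \<Phi>) p * extend_linear (scale_monomial \<Phi>) q"
    by (rule extend_linear_mult) (rule scale_monomial_add)
  assume "p \<noteq> 0"
  then obtain m where "m \<in> Poly_Mapping.keys p"
    by (metis all_not_in_conv keys_eq_empty)
  from extend_linear_scale_nth_nonzero[OF this, of \<Phi>]
  show "extend_linear (scale_monomial \<Phi>) p \<noteq> 0" by (metis fls_zero_nth)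
qed

text \<open>
  The substitution \<open>K \<rightarrow> K((z))\<close> that multiplies each indeterminate outside \<open>\<Phi>\<close> by \<open>z\<close> and fixes the others.
  The order of the resulting Laurent series is a discrete valuation on \<open>K\<close> that is trivial on the
  rational functions in the indeterminates from \<open>\<Phi>\<close> and positive on the other indeterminates.
\<close>

definition scale :: "'i set \<Rightarrow> 'i ratfun \<Rightarrow> 'i ratfun fls"
  where "scale \<Phi> = extend_fract (extend_linear (scale_monomial \<Phi>))"

definition indet :: "'i \<Rightarrow> 'i ratfun"
  where "indet i = monomial_fract (Poly_Mapping.single (wrap i) 1)"

lemma scale_hom:
  "scale \<Phi> 0 = 0" "scale \<Phi> 1 = 1" "scale \<Phi> (x + y) = scale \<Phi> x + scale \<Phi> y"
  "scale \<Phi> (x * y) = scale \<Phi> x * scale \<Phi> y" "scale \<Phi> (- x) = - scale \<Phi> x"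
  "scale \<Phi> (x ^ n) = scale \<Phi> x ^ n" "scale \<Phi> (x / y) = scale \<Phi> x / scale \<Phi> y"
  by (simp_all only: scale_def scale.extend_zero scale.extend_one scale.extend_add
      scale.extend_mult scale.extend_uminus scale.extend_power scale.extend_divide)

lemma scale_eq_0_iff [simp]: "scale \<Phi> x = 0 \<longleftrightarrow> x = 0"
  using scale.extend_nonzero[of x \<Phi>] scale_hom(1)[of \<Phi>] by (auto simp: scale_def)

lemma scale_indet:
  "scale \<Phi> (indet i) = (if i \<in> \<Phi> then 1 else fls_X) * fls_const (indet i)"
proof -
  have "scale \<Phi> (indet i) = scale_monomial \<Phi> (Poly_Mapping.single (wrap i) 1)"
    unfolding scale_def indet_def monomial_fract_def
    by (simp add: scale.extend_Fract scale.one extend_linear_single)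
  also have "outer_degree \<Phi> (Poly_Mapping.single (wrap i) 1) = (if i \<in> \<Phi> then 0 else 1)"
    by (simp add: outer_degree_def wrap_inverse)
  then have "scale_monomial \<Phi> (Poly_Mapping.single (wrap i) 1) =
      (if i \<in> \<Phi> then 1 else fls_X) * fls_const (indet i)"
    by (simp add: scale_monomial_def indet_def)
  finally show ?thesis .
qed

lemma sum_indets_nonzero:
  assumes "finite A" "A \<noteq> {}"
  shows "(\<Sum>i\<in>A. indet i) \<noteq> 0"
proof -
  have Fract_sum: "(\<Sum>a\<in>A. Fract (f a) 1) = Fract (\<Sum>a\<in>A. f a) 1" for f :: "'a \<Rightarrow> 'a mpoly"
    by (induction A rule: infinite_finite_induct) (simp_all add: Zero_fract_def)
  obtain a where "a \<in> A" using assms by blast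
  have "Poly_Mapping.lookup (\<Sum>i\<in>A. Poly_Mapping.single (Poly_Mapping.single (wrap i) (1::nat)) (1::int))
      (Poly_Mapping.single (wrap a) 1) = (\<Sum>i\<in>A. if i = a then 1 else 0 :: int)"
    unfolding lookup_sum
  proof (rule sum.cong[OF refl])
    fix i
    have "Poly_Mapping.single (wrap i) (1::nat) = Poly_Mapping.single (wrap a) 1 \<longleftrightarrow> i = a"
      by (metis lookup_single_eq lookup_single_not_eq one_neq_zero UNIV_I wrap_inject)
    then show "Poly_Mapping.lookup (Poly_Mapping.single (Poly_Mapping.single (wrap i) (1::nat)) 1)
        (Poly_Mapping.single (wrap a) 1) = (if i = a then 1 else 0 :: int)"
      by (auto simp: lookup_single when_def)
  qed
  also have "\<dots> = 1" using assms \<open>a \<in> A\<close> by simp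
  finally have "(\<Sum>i\<in>A. Poly_Mapping.single (Poly_Mapping.single (wrap i) (1::nat)) (1::int)) \<noteq> 0"
    by auto
  then show ?thesis
    by (simp add: indet_def monomial_fract_def Fract_sum Zero_fract_def eq_fract)
qed

text \<open>
  For a fraction \<open>p / q\<close>, the order of the rescaled \<open>p\<close> is at most the total degree of any
  monomial of \<open>p\<close>, whatever \<open>\<Phi>\<close> is, and the order of the rescaled \<open>q\<close> is nonnegative. So all these
  valuations have a common bound at a given nonzero element.
\<close>

lemma scale_subdegree_bounded:
  assumes "x \<noteq> 0"
  obtains N where "\<And>\<Phi>. fls_subdegree (scale \<Phi> x) \<le> int N"
proof -
  obtain p q where x: "x = Fract p q" and "q \<noteq> 0" by (cases x)
  then have "p \<noteq> 0" using assms by (auto simp: Zero_fract_def eq_fract)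
  then obtain m where m: "m \<in> Poly_Mapping.keys p"
    by (metis all_not_in_conv keys_eq_empty)
  have "fls_subdegree (scale \<Phi> x) \<le> int (outer_degree {} m)" for \<Phi>
  proof -
    let ?h = "extend_linear (scale_monomial \<Phi>)"
    have "scale \<Phi> x = ?h p / ?h q"
      using \<open>q \<noteq> 0\<close> by (simp add: x scale_def scale.extend_Fract)
    then have "fls_subdegree (scale \<Phi> x) = fls_subdegree (?h p) - fls_subdegree (?h q)"
      using \<open>p \<noteq> 0\<close> \<open>q \<noteq> 0\<close> by (simp add: fls_divide_subdegree scale.nonzero)
    moreover have "fls_subdegree (?h p) \<le> int (outer_degree \<Phi> m)"
      by (rule fls_subdegree_leI) (rule extend_linear_scale_nth_nonzero[OF m])
    ultimately show ?thesis
      using extend_linear_scale_ge0[of \<Phi> q] outer_degree_le[of \<Phi> m] by linarith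
  qed
  then show thesis by (rule that)
qed

section \<open>The size of the field\<close>

lemma infinite_times_eqpoll_self:
  assumes "infinite A"
  shows "A \<times> A \<approx> A"
  using assms card_of_Times_same_infinite by (simp add: eqpoll_iff_card_of_ordIso)

lemma poly_mapping_lepoll:
  assumes "infinite (UNIV :: 'n set)" "(UNIV :: 'a set) \<lesssim> (UNIV :: 'n set)"
    "(UNIV :: 'b::zero set) \<lesssim> (UNIV :: 'n set)"
  shows "(UNIV :: ('a \<Rightarrow>\<^sub>0 'b) set) \<lesssim> (UNIV :: 'n set)"
proof -
  have square: "(UNIV :: 'n set) \<times> (UNIV :: 'n set) \<approx> (UNIV :: 'n set)"
    using assms(1) by (rule infinite_times_eqpoll_self)
  have "(UNIV :: ('a \<Rightarrow>\<^sub>0 'b) set) \<lesssim> {f :: 'a \<Rightarrow> 'b. f ` UNIV \<subseteq> UNIV \<and> {x. f x \<noteq> 0} \<subseteq> UNIV \<and> finite {x. f x \<noteq> 0}}"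
    unfolding lepoll_def
    by (rule exI[of _ Poly_Mapping.lookup]) (auto intro!: inj_onI poly_mapping_eqI)
  also have "\<dots> \<lesssim> Fpow ((UNIV :: 'a set) \<times> (UNIV :: 'b set))"
    by (rule lepoll_restricted_funspace)
  also have "\<dots> \<lesssim> Fpow ((UNIV :: 'n set) \<times> (UNIV :: 'n set))"
  proof -
    from times_lepoll_mono[OF assms(2,3)]
    obtain g :: "'a \<times> 'b \<Rightarrow> 'n \<times> 'n" where "inj g" by (auto simp: lepoll_def)
    then have "inj_on ((`) g) (Fpow UNIV)" by (rule inj_on_image_Fpow)
    moreover have "(`) g ` Fpow UNIV \<subseteq> Fpow UNIV" by (auto simp: Fpow_def)
    ultimately show ?thesis unfolding lepoll_def UNIV_Times_UNIV by blast
  qed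
  also have "\<dots> \<approx> (UNIV :: 'n set) \<times> (UNIV :: 'n set)"
    by (rule eqpoll_Fpow) (use assms(1) in \<open>auto simp: finite_prod\<close>)
  also note square
  finally show ?thesis .
qed

lemma fract_lepoll:
  assumes "infinite (UNIV :: 'n set)" "(UNIV :: 'p::idom set) \<lesssim> (UNIV :: 'n set)"
  shows "(UNIV :: 'p fract set) \<lesssim> (UNIV :: 'n set)"
proof -
  have "(UNIV :: 'p fract set) \<lesssim> (UNIV :: 'p set) \<times> (UNIV :: 'p set)"
  proof (rule subset_image_lepoll[where f = "\<lambda>(a, b). Fract a b"], rule subsetI)
    fix x :: "'p fract"
    obtain a b where "x = Fract a b" by (rule Fract_cases)
    then show "x \<in> (\<lambda>(a, b). Fract a b) ` (UNIV \<times> UNIV)" by auto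
  qed
  also have "\<dots> \<lesssim> (UNIV :: 'n set) \<times> (UNIV :: 'n set)"
    by (rule times_lepoll_mono[OF assms(2,2)])
  also have "\<dots> \<approx> (UNIV :: 'n set)"
    using assms(1) by (rule infinite_times_eqpoll_self)
  finally show ?thesis .
qed

text \<open>
  A spectral space has to be the spectrum of a ring whose elements are sets over \<open>'i set + nat\<close>, where
  \<open>'i set\<close> is the type of its points. Polynomials and their fractions are finite
  expressions, so the field embeds into the infinite type \<open>'i set + nat\<close>, and a function on the points
  is encoded by its graph.
\<close>

lemma ex_inj_ratfun_functions:
  "\<exists>e :: ('i set \<Rightarrow> 'i ratfun) \<Rightarrow> ('i set + nat) set. inj e"
proof -
  let ?N = "UNIV :: ('i set + nat) set"
  have inf: "infinite ?N"
    by (simp add: finite_Plus_UNIV_iff)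
  have "(UNIV :: 'i ordered set) \<lesssim> ?N"
    unfolding lepoll_def
    by (intro exI[of _ "\<lambda>x. Inl {unwrap x}"]) (auto simp: inj_on_def unwrap_inject)
  moreover have nat: "(UNIV :: nat set) \<lesssim> ?N"
    unfolding lepoll_def by (intro exI[of _ Inr]) (auto simp: inj_on_def)
  ultimately have "(UNIV :: 'i monomial set) \<lesssim> ?N"
    by (rule poly_mapping_lepoll[OF inf])
  moreover have "(UNIV :: int set) \<lesssim> ?N"
  proof (rule lepoll_trans[OF _ nat])
    show "(UNIV :: int set) \<lesssim> (UNIV :: nat set)"
      unfolding lepoll_def by (intro exI[of _ to_nat]) auto
  qed
  ultimately have "(UNIV :: 'i mpoly set) \<lesssim> ?N"
    by (rule poly_mapping_lepoll[OF inf])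
  then have "(UNIV :: 'i ratfun set) \<lesssim> ?N"
    by (rule fract_lepoll[OF inf])
  then obtain v :: "'i ratfun \<Rightarrow> 'i set + nat" where v: "inj v"
    by (auto simp: lepoll_def)
  from inf have "?N \<times> ?N \<lesssim> ?N"
    by (metis infinite_times_eqpoll_self eqpoll_imp_lepoll)
  then obtain c :: "('i set + nat) \<times> ('i set + nat) \<Rightarrow> 'i set + nat" where c: "inj c"
    by (auto simp: lepoll_def)
  define e where "e f = range (\<lambda>\<Phi>. c (Inl \<Phi>, v (f \<Phi>)))" for f :: "'i set \<Rightarrow> 'i ratfun"
  have "inj e"
  proof (rule injI, rule ext)
    fix f g \<Phi> assume "e f = e g"
    then have "c (Inl \<Phi>, v (f \<Phi>)) \<in> e g" unfolding e_def by blast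
    then obtain \<Psi> where "c (Inl \<Phi>, v (f \<Phi>)) = c (Inl \<Psi>, v (g \<Psi>))" unfolding e_def by blast
    then show "f \<Phi> = g \<Phi>" using c v by (auto simp: inj_eq)
  qed
  then show ?thesis by blast
qed

section \<open>Recognizing a prime spectrum\<close>

lemma prime_spectrum_image_ring:
  assumes "cring R" "inj_on e (carrier R)"
  shows "prime_spectrum (image_ring e R) = (`) e ` prime_spectrum R"
proof -
  let ?S = "image_ring e R"
  interpret R: cring R by fact
  have e: "e \<in> ring_iso R ?S" using assms(2) by (rule inj_imp_image_ring_iso)
  define d where "d = inv_into (carrier R) e"
  have d: "d \<in> ring_iso ?S R" unfolding d_def by (rule ring_iso_set_sym[OF R.ring_axioms e])
  have S: "cring ?S"
    using R.ring_iso_imp_img_cring[OF e] by (simp add: image_ring_def image_group_def monoid.defs)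
  interpret S: cring ?S by fact
  have he: "ring_hom_ring R ?S e"
    using e by (intro ring_hom_ringI2 R.ring_axioms S.ring_axioms) (auto simp: ring_iso_def)
  have hd: "ring_hom_ring ?S R d"
    using d by (intro ring_hom_ringI2 R.ring_axioms S.ring_axioms) (auto simp: ring_iso_def)
  have de: "d (e x) = x" if "x \<in> carrier R" for x
    using that assms(2) by (simp add: d_def)
  have carr: "carrier ?S = e ` carrier R" by (rule image_ring_carrier)
  show ?thesis
  proof (intro equalityI subsetI)
    fix P assume "P \<in> prime_spectrum ?S"
    then have P: "primeideal P ?S" by (simp add: prime_spectrum_def)
    then interpret P: primeideal P ?S .
    have "primeideal {r \<in> carrier R. e r \<in> P} R"
      using ring_hom_ring.primeideal_vimage[OF he assms(1) P] .
    moreover have "P = e ` {r \<in> carrier R. e r \<in> P}"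
      using P.a_subset unfolding carr by blast
    ultimately show "P \<in> (`) e ` prime_spectrum R"
      unfolding prime_spectrum_def by blast
  next
    fix P assume "P \<in> (`) e ` prime_spectrum R"
    then obtain Q where Q: "primeideal Q R" "P = e ` Q"
      by (auto simp: prime_spectrum_def)
    then interpret Q: primeideal Q R by blast
    have "primeideal {s \<in> carrier ?S. d s \<in> Q} ?S"
      using ring_hom_ring.primeideal_vimage[OF hd S Q(1)] .
    also have "{s \<in> carrier ?S. d s \<in> Q} = P"
      using Q.a_subset Q(2) unfolding carr by (auto simp: de)
    finally show "P \<in> prime_spectrum ?S" by (simp add: prime_spectrum_def)
  qed
qed

text \<open>
  A bijection onto the primes is a homeomorphism if nonvanishing loci are open, which gives
  continuity, and if each member of a generating family of open sets is a nonvanishing locus, which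
  gives openness.
\<close>

lemma homeomorphic_prime_spectrumI:
  assumes bij: "bij_betw \<pi> (topspace T) (prime_spectrum R)"
    and open_nonvanishing: "\<And>f. f \<in> carrier R \<Longrightarrow> openin T {x \<in> topspace T. f \<notin> \<pi> x}"
    and T: "T = topology_generated_by \<B>"
    and basic: "\<And>U. U \<in> \<B> \<Longrightarrow> \<exists>f\<in>carrier R. U = {x \<in> topspace T. f \<notin> \<pi> x}"
  shows "T homeomorphic_space prime_spectrum_topology R"
proof -
  let ?Y = "prime_spectrum_topology R"
  define \<xi> where "\<xi> = inv_into (topspace T) \<pi>"
  have \<xi>: "\<xi> P \<in> topspace T" "\<pi> (\<xi> P) = P" if "P \<in> prime_spectrum R" for P
    unfolding \<xi>_def using bij_betwE[OF bij_betw_inv_into[OF bij]] bij_betw_inv_into_right[OF bij] that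
    by blast+
  have \<xi>\<pi>: "\<xi> (\<pi> x) = x" if "x \<in> topspace T" for x
    unfolding \<xi>_def by (rule bij_betw_inv_into_left[OF bij that])
  have \<pi>: "\<pi> x \<in> prime_spectrum R" if "x \<in> topspace T" for x
    using bij_betwE[OF bij] that by blast
  have Y: "topspace ?Y = prime_spectrum R" by (rule topspace_prime_spectrum_topology)
  have "continuous_map T ?Y \<pi>"
    unfolding prime_spectrum_topology_def
  proof (rule continuous_on_generated_topo)
    fix U assume "U \<in> {{P \<in> prime_spectrum R. f \<notin> P} | f. f \<in> carrier R}"
    then obtain f where f: "f \<in> carrier R" "U = {P \<in> prime_spectrum R. f \<notin> P}" by blast
    have "\<pi> -` U \<inter> topspace T = {x \<in> topspace T. f \<notin> \<pi> x}" using f \<pi> by auto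
    then show "openin T (\<pi> -` U \<inter> topspace T)" using open_nonvanishing[OF f(1)] by simp
  next
    show "\<pi> ` topspace T \<subseteq> \<Union>{{P \<in> prime_spectrum R. f \<notin> P} | f. f \<in> carrier R}"
      using \<pi> Y by (auto simp: prime_spectrum_topology_def topology_generated_by_topspace)
  qed
  moreover have "continuous_map ?Y T \<xi>"
    unfolding T
  proof (rule continuous_on_generated_topo)
    fix U assume "U \<in> \<B>"
    then obtain f where f: "f \<in> carrier R" "U = {x \<in> topspace T. f \<notin> \<pi> x}"
      using basic by blast
    have "\<xi> -` U \<inter> topspace ?Y = {P \<in> prime_spectrum R. f \<notin> P}"
      unfolding Y f(2) using \<xi> by auto
    then show "openin ?Y (\<xi> -` U \<inter> topspace ?Y)"
      using f(1) by (auto simp: prime_spectrum_topology_def intro!: topology_generated_by_Basis)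
  next
    show "\<xi> ` topspace ?Y \<subseteq> \<Union>\<B>"
      using \<xi> unfolding Y by (auto simp: T topology_generated_by_topspace)
  qed
  ultimately show ?thesis
    unfolding homeomorphic_space_def homeomorphic_maps_def
    by (intro exI[of _ \<pi>] exI[of _ \<xi>]) (auto simp: Y \<xi> \<xi>\<pi>)
qed

section \<open>Specialization of Laurent series\<close>

text \<open>
  The place of \<open>K((z))\<close> at \<open>z = 0\<close>, as a relation: the series is integral and its value there is \<open>c\<close>.
\<close>

definition specializes :: "'k::field fls \<Rightarrow> 'k \<Rightarrow> bool"
  where "specializes L c \<longleftrightarrow> (\<exists>g. L = fps_to_fls g \<and> fps_nth g 0 = c)"

lemma specializes_unique: "specializes L c \<Longrightarrow> specializes L d \<Longrightarrow> c = d"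
  unfolding specializes_def by auto

lemma specializes_fls_const: "specializes (fls_const c) c"
  unfolding specializes_def by (intro exI[of _ "fps_const c"]) (auto simp: fls_eq_iff)

lemma specializes_zero: "specializes 0 0" and specializes_one: "specializes 1 1"
  using specializes_fls_const[of 0] specializes_fls_const[of 1] by auto

lemma specializes_add:
  assumes "specializes L c" "specializes M d"
  shows "specializes (L + M) (c + d)"
proof -
  from assms obtain g h where "L = fps_to_fls g" "fps_nth g 0 = c" "M = fps_to_fls h" "fps_nth h 0 = d"
    by (auto simp: specializes_def)
  then show ?thesis unfolding specializes_def by (intro exI[of _ "g + h"]) simp
qed

lemma specializes_uminus:
  assumes "specializes L c"
  shows "specializes (- L) (- c)"
proof -
  from assms obtain g where "L = fps_to_fls g" "fps_nth g 0 = c"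
    by (auto simp: specializes_def)
  then show ?thesis unfolding specializes_def by (intro exI[of _ "- g"]) simp
qed

lemma specializes_mult:
  assumes "specializes L c" "specializes M d"
  shows "specializes (L * M) (c * d)"
proof -
  from assms obtain g h where "L = fps_to_fls g" "fps_nth g 0 = c" "M = fps_to_fls h" "fps_nth h 0 = d"
    by (auto simp: specializes_def)
  then show ?thesis
    unfolding specializes_def by (intro exI[of _ "g * h"]) (simp add: fls_times_fps_to_fls)
qed

lemma specializes_power: "specializes L c \<Longrightarrow> specializes (L ^ n) (c ^ n)"
  by (induction n) (simp_all add: specializes_one specializes_mult)

lemma specializes_divide:
  assumes "specializes L c" "specializes M d" "d \<noteq> 0"
  shows "specializes (L / M) (c / d)"
proof -
  from assms(2) obtain g where g: "M = fps_to_fls g" "fps_nth g 0 = d"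
    by (auto simp: specializes_def)
  then have "inverse M = fps_to_fls (inverse g)"
    using assms(3) by (simp add: fls_inverse_fps_to_fls subdegree_eq_0)
  then have "specializes (inverse M) (inverse d)"
    unfolding specializes_def using g by auto
  from specializes_mult[OF assms(1) this] show ?thesis
    by (simp add: divide_inverse)
qed

lemma specializes_zeroI:
  assumes "0 < fls_subdegree L"
  shows "specializes L 0"
proof -
  have "L = fps_to_fls (fls_regpart L)"
    using assms by (simp add: fls_eq_iff)
  then show ?thesis
    unfolding specializes_def using assms by (intro exI[of _ "fls_regpart L"]) simp
qed

lemma specializes_zero_subdegree:
  assumes "specializes L 0" "L \<noteq> 0"
  shows "0 < fls_subdegree L"
proof -
  from assms(1) obtain g where g: "L = fps_to_fls g" "fps_nth g 0 = 0"
    by (auto simp: specializes_def)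
  then have "0 < subdegree g" using assms(2) by (metis fps_to_fls_eq_0_iff neq0_conv subdegree_eq_0_iff)
  then show ?thesis by (simp add: g fls_subdegree_fls_to_fps)
qed

section \<open>The space of filters of a preorder with finite meets\<close>

definition filters :: "'i set \<Rightarrow> ('i \<Rightarrow> 'i \<Rightarrow> bool) \<Rightarrow> 'i set set"
  where "filters B below = {\<Phi>. \<Phi> \<subseteq> B \<and> \<Phi> \<noteq> {} \<and>
    (\<forall>i\<in>\<Phi>. \<forall>j\<in>B. below i j \<longrightarrow> j \<in> \<Phi>) \<and>
    (\<forall>i\<in>\<Phi>. \<forall>j\<in>\<Phi>. \<exists>k\<in>\<Phi>. below k i \<and> below k j)}"

definition filter_topology :: "'i set \<Rightarrow> ('i \<Rightarrow> 'i \<Rightarrow> bool) \<Rightarrow> 'i set topology"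
  where "filter_topology B below = topology_generated_by {{\<Phi> \<in> filters B below. i \<in> \<Phi>} | i. i \<in> B}"

lemma topspace_filter_topology: "topspace (filter_topology B below) = filters B below"
  unfolding filter_topology_def topology_generated_by_topspace filters_def by blast

text \<open>
  A preorder is used instead of a semilattice, since finitely generated ideals are compared up to
  an equivalence that is coarser than equality.
\<close>

locale meet_preorder =
  fixes B :: "'i set" and below :: "'i \<Rightarrow> 'i \<Rightarrow> bool" (infix "\<preceq>" 50)
  assumes le_refl: "i \<in> B \<Longrightarrow> i \<preceq> i"
    and le_trans: "i \<in> B \<Longrightarrow> j \<in> B \<Longrightarrow> k \<in> B \<Longrightarrow> i \<preceq> j \<Longrightarrow> j \<preceq> k \<Longrightarrow> i \<preceq> k"
    and ex_top: "\<exists>e\<in>B. \<forall>i\<in>B. i \<preceq> e"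
    and ex_meet: "i \<in> B \<Longrightarrow> j \<in> B \<Longrightarrow>
      \<exists>k\<in>B. k \<preceq> i \<and> k \<preceq> j \<and> (\<forall>l\<in>B. l \<preceq> i \<and> l \<preceq> j \<longrightarrow> l \<preceq> k)"
begin

abbreviation points :: "'i set set"
  where "points \<equiv> filters B below"

lemma filter_mono: "\<Phi> \<in> points \<Longrightarrow> i \<in> \<Phi> \<Longrightarrow> j \<in> B \<Longrightarrow> i \<preceq> j \<Longrightarrow> j \<in> \<Phi>"
  and filter_subset: "\<Phi> \<in> points \<Longrightarrow> \<Phi> \<subseteq> B"
  and filter_directed: "\<Phi> \<in> points \<Longrightarrow> i \<in> \<Phi> \<Longrightarrow> j \<in> \<Phi> \<Longrightarrow> \<exists>k\<in>\<Phi>. k \<preceq> i \<and> k \<preceq> j"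
  by (auto simp: filters_def)

text \<open>
  The principal filter of \<open>i\<close> is the smallest point of the basic open set given by \<open>i\<close>. The existence of
  such a point is what makes the construction below work: it shows that the nonvanishing locus of
  a function is a finite union of basic open sets.
\<close>

definition principal :: "'i \<Rightarrow> 'i set"
  where "principal i = {j \<in> B. i \<preceq> j}"

lemma principal_in_points:
  assumes "i \<in> B"
  shows "principal i \<in> points"
  unfolding filters_def principal_def using assms le_refl le_trans by blast

lemma principal_least: "\<Phi> \<in> points \<Longrightarrow> i \<in> \<Phi> \<Longrightarrow> principal i \<subseteq> \<Phi>"
  unfolding principal_def using filter_mono by blast

lemma self_in_principal: "i \<in> B \<Longrightarrow> i \<in> principal i"
  unfolding principal_def using le_refl by blast

lemma ex_finite_meet:
  assumes "finite R" "R \<subseteq> B"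
  shows "\<exists>l\<in>B. \<forall>\<Phi>\<in>points. R \<subseteq> \<Phi> \<longleftrightarrow> l \<in> \<Phi>"
  using assms
proof (induction R rule: finite_induct)
  case empty
  obtain e where e: "e \<in> B" "\<forall>i\<in>B. i \<preceq> e" using ex_top by blast
  have "e \<in> \<Phi>" if "\<Phi> \<in> points" for \<Phi>
    using that e unfolding filters_def by blast
  then show ?case using e by blast
next
  case (insert r R)
  then obtain l where l: "l \<in> B" "\<forall>\<Phi>\<in>points. R \<subseteq> \<Phi> \<longleftrightarrow> l \<in> \<Phi>" by blast
  obtain k where k: "k \<in> B" "k \<preceq> r" "k \<preceq> l" "\<forall>m\<in>B. m \<preceq> r \<and> m \<preceq> l \<longrightarrow> m \<preceq> k"
    using ex_meet[of r l] insert l by blast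
  have "insert r R \<subseteq> \<Phi> \<longleftrightarrow> k \<in> \<Phi>" if \<Phi>: "\<Phi> \<in> points" for \<Phi>
  proof
    assume "insert r R \<subseteq> \<Phi>"
    then have "r \<in> \<Phi>" "l \<in> \<Phi>" using l \<Phi> by auto
    then obtain m where "m \<in> \<Phi>" "m \<preceq> r" "m \<preceq> l" using filter_directed[OF \<Phi>] by blast
    then show "k \<in> \<Phi>" using k filter_subset[OF \<Phi>] filter_mono[OF \<Phi>] by blast
  next
    assume "k \<in> \<Phi>"
    then have "r \<in> \<Phi>" "l \<in> \<Phi>" using k l insert.prems filter_mono[OF \<Phi>] by blast+
    then show "insert r R \<subseteq> \<Phi>" using l \<Phi> by blast
  qed
  then show ?case using k by blast
qed

section \<open>The ring of coherent functions\<close>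

text \<open>
  If \<open>\<Phi> \<subseteq> \<Psi>\<close>, then the point \<open>\<Phi>\<close> lies in the closure of \<open>\<Psi>\<close>, because every basic open set that contains
  \<open>\<Phi>\<close> contains \<open>\<Psi>\<close>. The value of a coherent function at \<open>\<Psi>\<close> must therefore specialize to its value
  at \<open>\<Phi>\<close>, along the place in which the indeterminates outside \<open>\<Phi>\<close> vanish. The second condition, that
  the value depends on finitely many memberships only, is what replaces the compactness of the
  nonvanishing loci. Functions are set to \<open>0\<close> away from the filters, so that equality of functions is
  equality at the points.
\<close>

definition coherent :: "('i set \<Rightarrow> 'i ratfun) set"
  where "coherent = {f. (\<forall>\<Phi>. \<Phi> \<notin> points \<longrightarrow> f \<Phi> = 0) \<and>
    (\<exists>S. finite S \<and> (\<forall>\<Phi>\<in>points. \<forall>\<Psi>\<in>points. \<Phi> \<inter> S = \<Psi> \<inter> S \<longrightarrow> f \<Phi> = f \<Psi>)) \<and>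
    (\<forall>\<Phi>\<in>points. \<forall>\<Psi>\<in>points. \<Phi> \<subseteq> \<Psi> \<longrightarrow> specializes (scale \<Phi> (f \<Psi>)) (f \<Phi>))}"

definition coherent_ring :: "('i set \<Rightarrow> 'i ratfun) ring"
  where "coherent_ring = \<lparr>carrier = coherent, mult = (\<lambda>f g \<Phi>. f \<Phi> * g \<Phi>),
    one = (\<lambda>\<Phi>. if \<Phi> \<in> points then 1 else 0), ring.zero = (\<lambda>\<Phi>. 0), ring.add = (\<lambda>f g \<Phi>. f \<Phi> + g \<Phi>)\<rparr>"

lemma coherent_ring_simps:
  "carrier coherent_ring = coherent"
  "(f \<otimes>\<^bsub>coherent_ring\<^esub> g) \<Phi> = f \<Phi> * g \<Phi>"
  "\<one>\<^bsub>coherent_ring\<^esub> \<Phi> = (if \<Phi> \<in> points then 1 else 0)"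
  "\<zero>\<^bsub>coherent_ring\<^esub> \<Phi> = 0"
  "(f \<oplus>\<^bsub>coherent_ring\<^esub> g) \<Phi> = f \<Phi> + g \<Phi>"
  by (simp_all add: coherent_ring_def)

lemma coherentI:
  assumes "\<And>\<Phi>. \<Phi> \<notin> points \<Longrightarrow> f \<Phi> = 0" "finite S"
    and "\<And>\<Phi> \<Psi>. \<Phi> \<in> points \<Longrightarrow> \<Psi> \<in> points \<Longrightarrow> \<Phi> \<inter> S = \<Psi> \<inter> S \<Longrightarrow> f \<Phi> = f \<Psi>"
    and "\<And>\<Phi> \<Psi>. \<Phi> \<in> points \<Longrightarrow> \<Psi> \<in> points \<Longrightarrow> \<Phi> \<subseteq> \<Psi> \<Longrightarrow> specializes (scale \<Phi> (f \<Psi>)) (f \<Phi>)"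
  shows "f \<in> coherent"
  unfolding coherent_def
  by (intro CollectI conjI exI[of _ S] allI ballI impI; (rule assms; assumption)?)

lemma coherentD:
  assumes "f \<in> coherent"
  shows "\<Phi> \<notin> points \<Longrightarrow> f \<Phi> = 0"
    and "\<Phi> \<in> points \<Longrightarrow> \<Psi> \<in> points \<Longrightarrow> \<Phi> \<subseteq> \<Psi> \<Longrightarrow> specializes (scale \<Phi> (f \<Psi>)) (f \<Phi>)"
  using assms by (simp_all add: coherent_def)

lemma coherent_finite_dependence:
  assumes "f \<in> coherent"
  obtains S where "finite S"
    "\<forall>\<Phi>\<in>points. \<forall>\<Psi>\<in>points. \<Phi> \<inter> S = \<Psi> \<inter> S \<longrightarrow> f \<Phi> = f \<Psi>"
proof -
  from assms have "\<exists>S. finite S \<and> (\<forall>\<Phi>\<in>points. \<forall>\<Psi>\<in>points. \<Phi> \<inter> S = \<Psi> \<inter> S \<longrightarrow> f \<Phi> = f \<Psi>)"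
    by (simp add: coherent_def)
  then show thesis using that by (elim exE conjE)
qed

lemma coherent_pointwise:
  assumes f: "f \<in> coherent" and g: "g \<in> coherent"
    and h: "\<And>\<Phi>. \<Phi> \<in> points \<Longrightarrow> h \<Phi> = F (f \<Phi>) (g \<Phi>)" "\<And>\<Phi>. \<Phi> \<notin> points \<Longrightarrow> h \<Phi> = 0"
    and spec: "\<And>\<Phi> \<Psi>. \<Phi> \<in> points \<Longrightarrow> \<Psi> \<in> points \<Longrightarrow> \<Phi> \<subseteq> \<Psi> \<Longrightarrow>
      specializes (scale \<Phi> (f \<Psi>)) (f \<Phi>) \<Longrightarrow> specializes (scale \<Phi> (g \<Psi>)) (g \<Phi>) \<Longrightarrow>
      specializes (scale \<Phi> (F (f \<Psi>) (g \<Psi>))) (F (f \<Phi>) (g \<Phi>))"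
  shows "h \<in> coherent"
proof -
  obtain S where S: "finite S" "\<forall>\<Phi>\<in>points. \<forall>\<Psi>\<in>points. \<Phi> \<inter> S = \<Psi> \<inter> S \<longrightarrow> f \<Phi> = f \<Psi>"
    by (rule coherent_finite_dependence[OF f])
  obtain T where T: "finite T" "\<forall>\<Phi>\<in>points. \<forall>\<Psi>\<in>points. \<Phi> \<inter> T = \<Psi> \<inter> T \<longrightarrow> g \<Phi> = g \<Psi>"
    by (rule coherent_finite_dependence[OF g])
  show ?thesis
  proof (rule coherentI[where S = "S \<union> T"])
    fix \<Phi> \<Psi> assume \<Phi>\<Psi>: "\<Phi> \<in> points" "\<Psi> \<in> points"
    show "h \<Phi> = h \<Psi>" if "\<Phi> \<inter> (S \<union> T) = \<Psi> \<inter> (S \<union> T)"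
    proof -
      from that have "\<Phi> \<inter> S = \<Psi> \<inter> S" "\<Phi> \<inter> T = \<Psi> \<inter> T" by blast+
      then show ?thesis using S(2)[rule_format, OF \<Phi>\<Psi>] T(2)[rule_format, OF \<Phi>\<Psi>] by (simp add: h(1) \<Phi>\<Psi>)
    qed
    show "specializes (scale \<Phi> (h \<Psi>)) (h \<Phi>)" if "\<Phi> \<subseteq> \<Psi>"
      using spec[OF \<Phi>\<Psi> that coherentD(2)[OF f \<Phi>\<Psi> that] coherentD(2)[OF g \<Phi>\<Psi> that]]
      by (simp add: h(1) \<Phi>\<Psi>)
  qed (use S T h(2) in auto)
qed

lemma coherent_one: "(\<lambda>\<Phi>. if \<Phi> \<in> points then 1 else 0) \<in> coherent"
  by (rule coherentI[where S = "{}"]) (auto simp: scale_hom specializes_one)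

lemma coherent_zero: "(\<lambda>\<Phi>. 0) \<in> coherent"
  by (rule coherentI[where S = "{}"]) (auto simp: scale_hom specializes_zero)

lemma coherent_add: "f \<in> coherent \<Longrightarrow> g \<in> coherent \<Longrightarrow> (\<lambda>\<Phi>. f \<Phi> + g \<Phi>) \<in> coherent"
  by (rule coherent_pointwise[where F = "(+)"])
     (auto simp: scale_hom coherentD(1) intro: specializes_add)

lemma coherent_mult: "f \<in> coherent \<Longrightarrow> g \<in> coherent \<Longrightarrow> (\<lambda>\<Phi>. f \<Phi> * g \<Phi>) \<in> coherent"
  by (rule coherent_pointwise[where F = "(*)"])
     (auto simp: scale_hom coherentD(1) intro: specializes_mult)

lemma coherent_uminus: "f \<in> coherent \<Longrightarrow> (\<lambda>\<Phi>. - f \<Phi>) \<in> coherent"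
  by (rule coherent_pointwise[where F = "\<lambda>x y. - x" and g = f])
     (auto simp: scale_hom coherentD(1) intro: specializes_uminus)

sublocale coh: cring coherent_ring
proof (rule cringI)
  show "abelian_group coherent_ring"
  proof (rule abelian_groupI)
    fix f assume "f \<in> carrier coherent_ring"
    then have "(\<lambda>\<Phi>. - f \<Phi>) \<in> carrier coherent_ring"
      by (simp add: coherent_ring_def coherent_uminus)
    moreover have "(\<lambda>\<Phi>. - f \<Phi>) \<oplus>\<^bsub>coherent_ring\<^esub> f = \<zero>\<^bsub>coherent_ring\<^esub>"
      by (simp add: coherent_ring_def)
    ultimately show "\<exists>g\<in>carrier coherent_ring. g \<oplus>\<^bsub>coherent_ring\<^esub> f = \<zero>\<^bsub>coherent_ring\<^esub>"
      by blast
  qed (auto simp: coherent_ring_def coherent_add coherent_zero add_ac)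
  show "comm_monoid coherent_ring"
    by (rule comm_monoidI)
       (auto simp: coherent_ring_def coherent_mult coherent_one mult_ac fun_eq_iff coherentD(1))
qed (simp add: coherent_ring_def distrib_right)

lemma coherent_ring_pow:
  "(f [^]\<^bsub>coherent_ring\<^esub> n) \<Phi> = (if \<Phi> \<in> points then f \<Phi> ^ n else 0)" if "f \<in> coherent" for n :: nat
  by (induction n) (auto simp: coherent_ring_simps coherentD(1)[OF that])

text \<open>
  The value at \<open>\<Phi>\<close> is the constant coefficient of a series that would be \<open>0\<close> if the value at \<open>\<Psi>\<close> were.
\<close>

lemma nonvanishing_mono:
  assumes "f \<in> coherent" "\<Phi> \<in> points" "\<Psi> \<in> points" "\<Phi> \<subseteq> \<Psi>" "f \<Phi> \<noteq> 0"
  shows "f \<Psi> \<noteq> 0"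
  using coherentD(2)[OF assms(1-4)] assms(5) specializes_unique specializes_zero
  by (metis scale_hom(1))

text \<open>
  The function that cuts out the basic open set of \<open>i\<close>: its nonvanishing locus consists of the filters
  that contain \<open>i\<close>.
\<close>

definition coord :: "'i \<Rightarrow> 'i set \<Rightarrow> 'i ratfun"
  where "coord i \<Phi> = (if \<Phi> \<in> points \<and> i \<in> \<Phi> then indet i else 0)"

lemma indet_nonzero: "indet i \<noteq> 0"
  using sum_indets_nonzero[of "{i}"] by simp

lemma coord_nonzero_iff: "\<Phi> \<in> points \<Longrightarrow> coord i \<Phi> \<noteq> 0 \<longleftrightarrow> i \<in> \<Phi>"
  by (simp add: coord_def indet_nonzero)

lemma coord_coherent: "coord i \<in> coherent"
proof -
  have "specializes (scale \<Phi> (coord i \<Psi>)) (coord i \<Phi>)"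
    if "\<Phi> \<in> points" "\<Psi> \<in> points" "\<Phi> \<subseteq> \<Psi>" for \<Phi> \<Psi>
  proof (cases "i \<in> \<Psi>")
    case False
    then show ?thesis using that by (auto simp: coord_def scale_hom specializes_zero)
  next
    case True
    have "0 < fls_subdegree (fls_X * fls_const (indet i))"
      by (simp add: fls_subdegree_mult indet_nonzero)
    then show ?thesis
      using that True by (auto simp: coord_def scale_indet specializes_fls_const intro: specializes_zeroI)
  qed
  then show ?thesis
    by (intro coherentI[where S = "{i}"]) (auto simp: coord_def)
qed

text \<open>
  The value at \<open>\<Phi>\<close> is determined by \<open>\<Phi> \<inter> S\<close> for a fixed finite \<open>S\<close>.
\<close>

lemma finite_range_coherent:
  assumes "f \<in> coherent"
  shows "finite (f ` points)"
proof -
  obtain S where S: "finite S" "\<forall>\<Phi>\<in>points. \<forall>\<Psi>\<in>points. \<Phi> \<inter> S = \<Psi> \<inter> S \<longrightarrow> f \<Phi> = f \<Psi>"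
    by (rule coherent_finite_dependence[OF assms])
  define c where "c R = (SOME x. \<exists>\<Phi>\<in>points. \<Phi> \<inter> S = R \<and> x = f \<Phi>)" for R
  have "f \<Phi> = c (\<Phi> \<inter> S)" if "\<Phi> \<in> points" for \<Phi>
  proof -
    have "\<exists>x. \<exists>\<Psi>\<in>points. \<Psi> \<inter> S = \<Phi> \<inter> S \<and> x = f \<Psi>" using that by blast
    from someI_ex[OF this] show ?thesis unfolding c_def using S(2) that by metis
  qed
  then have "f ` points \<subseteq> c ` Pow S" by auto
  then show ?thesis using S(1) by (meson finite_Pow_iff finite_imageI finite_subset)
qed

lemma subdegree_bounded:
  assumes "f \<in> coherent"
  obtains N where "\<And>\<Phi> \<Psi>. \<Psi> \<in> points \<Longrightarrow> f \<Psi> \<noteq> 0 \<Longrightarrow> fls_subdegree (scale \<Phi> (f \<Psi>)) \<le> int N"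
proof -
  have "\<exists>N. \<forall>\<Phi>. x \<noteq> 0 \<longrightarrow> fls_subdegree (scale \<Phi> x) \<le> int N" for x :: "'i ratfun"
    by (metis scale_subdegree_bounded)
  then obtain b where b: "\<And>x \<Phi>. x \<noteq> 0 \<Longrightarrow> fls_subdegree (scale \<Phi> (x :: 'i ratfun)) \<le> int (b x)"
    by metis
  show thesis
  proof (rule that)
    fix \<Phi> \<Psi> assume "\<Psi> \<in> points" "f \<Psi> \<noteq> 0"
    then have "fls_subdegree (scale \<Phi> (f \<Psi>)) \<le> int (b (f \<Psi>))" by (simp add: b)
    also have "b (f \<Psi>) \<le> Max (b ` f ` points)"
      using finite_range_coherent[OF assms] \<open>\<Psi> \<in> points\<close> by simp
    then have "int (b (f \<Psi>)) \<le> int (Max (b ` f ` points))" by simp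
    finally show "fls_subdegree (scale \<Phi> (f \<Psi>)) \<le> int (Max (b ` f ` points))" .
  qed
qed

text \<open>
  If \<open>g\<close> vanishes wherever \<open>f\<close> does, then \<open>f\<close> divides a power of \<open>g\<close>: the pointwise quotient
  \<open>g\<^sup>n / f\<close>, with value \<open>0\<close> where \<open>f\<close> vanishes, is coherent for large \<open>n\<close>. At a point where \<open>g\<close> does not vanish,
  neither does \<open>f\<close>, and quotients of units specialize to quotients. At a point where \<open>g\<close> vanishes, the
  relevant valuation of \<open>g\<close> is at least \<open>1\<close>, so that of \<open>g\<^sup>n\<close> is at least \<open>n\<close>, which exceeds the uniform
  bound for the valuation of \<open>f\<close>. Then \<open>g\<^sup>n / f\<close> specializes to \<open>0\<close>, as required.
\<close>

lemma divides_power: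
  assumes f: "f \<in> coherent" and g: "g \<in> coherent"
    and supp: "\<And>\<Phi>. \<Phi> \<in> points \<Longrightarrow> g \<Phi> \<noteq> 0 \<Longrightarrow> f \<Phi> \<noteq> 0"
  obtains h n where "h \<in> coherent" "g [^]\<^bsub>coherent_ring\<^esub> (n::nat) = f \<otimes>\<^bsub>coherent_ring\<^esub> h"
proof -
  obtain N where N: "\<And>\<Phi> \<Psi>. \<Psi> \<in> points \<Longrightarrow> f \<Psi> \<noteq> 0 \<Longrightarrow> fls_subdegree (scale \<Phi> (f \<Psi>)) \<le> int N"
    using subdegree_bounded[OF f] by blast
  define h where "h \<Phi> = (if \<Phi> \<in> points then g \<Phi> ^ Suc N / f \<Phi> else 0)" for \<Phi>
  have "h \<in> coherent"
  proof (rule coherent_pointwise[where F = "\<lambda>x y. y ^ Suc N / x", OF f g])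
    fix \<Phi> \<Psi> assume \<Phi>\<Psi>: "\<Phi> \<in> points" "\<Psi> \<in> points" "\<Phi> \<subseteq> \<Psi>"
      and f_spec: "specializes (scale \<Phi> (f \<Psi>)) (f \<Phi>)"
      and g_spec: "specializes (scale \<Phi> (g \<Psi>)) (g \<Phi>)"
    show "specializes (scale \<Phi> (g \<Psi> ^ Suc N / f \<Psi>)) (g \<Phi> ^ Suc N / f \<Phi>)"
    proof (cases "g \<Phi> = 0")
      case False
      then show ?thesis
        unfolding scale_hom
        by (intro specializes_divide specializes_power f_spec g_spec supp \<Phi>\<Psi>)
    next
      case gz: True
      show ?thesis
      proof (cases "g \<Psi> = 0")
        case True
        then show ?thesis using gz by (simp add: scale_hom specializes_zero)
      next
        case False
        then have nz: "scale \<Phi> (g \<Psi>) \<noteq> 0" "scale \<Phi> (f \<Psi>) \<noteq> 0"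
          using supp \<Phi>\<Psi> by auto
        have "1 \<le> fls_subdegree (scale \<Phi> (g \<Psi>))"
          using specializes_zero_subdegree[OF _ nz(1)] g_spec gz by simp
        then have "int (Suc N) \<le> int (Suc N) * fls_subdegree (scale \<Phi> (g \<Psi>))"
          by (simp add: mult_le_cancel_left1)
        moreover have "fls_subdegree (scale \<Phi> (f \<Psi>)) \<le> int N"
          using N \<Phi>\<Psi> False supp by blast
        moreover have "fls_subdegree (scale \<Phi> (g \<Psi>) ^ Suc N / scale \<Phi> (f \<Psi>)) =
            int (Suc N) * fls_subdegree (scale \<Phi> (g \<Psi>)) - fls_subdegree (scale \<Phi> (f \<Psi>))"
          using nz by (simp only: fls_divide_subdegree fls_subdegree_pow power_not_zero not_False_eq_True)
        ultimately have "0 < fls_subdegree (scale \<Phi> (g \<Psi>) ^ Suc N / scale \<Phi> (f \<Psi>))"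
          by linarith
        then show ?thesis
          using gz by (simp only: scale_hom) (simp add: specializes_zeroI)
      qed
    qed
  qed (simp_all add: h_def)
  moreover have "g [^]\<^bsub>coherent_ring\<^esub> (Suc N) = f \<otimes>\<^bsub>coherent_ring\<^esub> h"
  proof
    fix \<Phi>
    show "(g [^]\<^bsub>coherent_ring\<^esub> (Suc N)) \<Phi> = (f \<otimes>\<^bsub>coherent_ring\<^esub> h) \<Phi>"
      using supp[of \<Phi>] unfolding coherent_ring_pow[OF g] coherent_ring_simps h_def by auto
  qed
  ultimately show thesis by (rule that)
qed

text \<open>
  Let \<open>f \<Phi>\<close> depend only on \<open>\<Phi> \<inter> S\<close>, and let \<open>l\<close> be the meet of \<open>\<Phi> \<inter> S\<close>. The principal filter of \<open>l\<close> has the same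
  intersection with \<open>S\<close> as \<open>\<Phi>\<close>, so \<open>f\<close> takes the same value there. If this value is nonzero, then \<open>f\<close>
  is nonzero at all filters that contain \<open>l\<close>, because these contain the principal filter. Only finitely many
  \<open>l\<close> occur, since \<open>S\<close> has finitely many subsets.
\<close>

lemma support_finite_union:
  assumes f: "f \<in> coherent"
  obtains T where "finite T" "T \<subseteq> B" "\<forall>\<Phi>\<in>points. f \<Phi> \<noteq> 0 \<longleftrightarrow> (\<exists>i\<in>T. i \<in> \<Phi>)"
proof -
  obtain S where S: "finite S" "\<forall>\<Phi>\<in>points. \<forall>\<Psi>\<in>points. \<Phi> \<inter> S = \<Psi> \<inter> S \<longrightarrow> f \<Phi> = f \<Psi>"
    by (rule coherent_finite_dependence[OF f])
  have "\<exists>l\<in>B. \<forall>\<Phi>\<in>points. R \<inter> B \<subseteq> \<Phi> \<longleftrightarrow> l \<in> \<Phi>" if "R \<subseteq> S" for R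
    by (rule ex_finite_meet) (use that S(1) in \<open>auto intro: finite_subset\<close>)
  then obtain l where l: "\<And>R. R \<subseteq> S \<Longrightarrow> l R \<in> B"
    "\<And>R \<Phi>. R \<subseteq> S \<Longrightarrow> \<Phi> \<in> points \<Longrightarrow> R \<inter> B \<subseteq> \<Phi> \<longleftrightarrow> l R \<in> \<Phi>"
    by metis
  define T where "T = (\<lambda>\<Phi>. l (\<Phi> \<inter> S)) ` {\<Phi> \<in> points. f \<Phi> \<noteq> 0}"
  have value_at_meet: "l (\<Phi> \<inter> S) \<in> \<Phi>" "f (principal (l (\<Phi> \<inter> S))) = f \<Phi>" if \<Phi>: "\<Phi> \<in> points" for \<Phi>
  proof -
    let ?l = "l (\<Phi> \<inter> S)"
    have lB: "?l \<in> B" by (rule l(1)) blast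
    show l\<Phi>: "?l \<in> \<Phi>" using l(2)[of "\<Phi> \<inter> S" \<Phi>] \<Phi> by blast
    have P: "principal ?l \<in> points" by (rule principal_in_points[OF lB])
    have "\<Phi> \<inter> S \<inter> B \<subseteq> principal ?l"
      using l(2)[of "\<Phi> \<inter> S" "principal ?l"] P self_in_principal[OF lB] by blast
    then have "principal ?l \<inter> S = \<Phi> \<inter> S"
      using principal_least[OF \<Phi> l\<Phi>] filter_subset[OF \<Phi>] by blast
    then show "f (principal ?l) = f \<Phi>" by (rule S(2)[rule_format, OF P \<Phi>])
  qed
  show thesis
  proof (rule that)
    have "T \<subseteq> l ` Pow S" unfolding T_def by blast
    then show "finite T" using S(1) by (meson finite_Pow_iff finite_imageI finite_subset)
    show "T \<subseteq> B" unfolding T_def using l(1) by blast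
    show "\<forall>\<Psi>\<in>points. f \<Psi> \<noteq> 0 \<longleftrightarrow> (\<exists>i\<in>T. i \<in> \<Psi>)"
    proof (intro ballI iffI)
      fix \<Psi> assume \<Psi>: "\<Psi> \<in> points"
      assume "f \<Psi> \<noteq> 0"
      then show "\<exists>i\<in>T. i \<in> \<Psi>" unfolding T_def using value_at_meet(1)[OF \<Psi>] \<Psi> by blast
    next
      fix \<Psi> assume \<Psi>: "\<Psi> \<in> points"
      assume "\<exists>i\<in>T. i \<in> \<Psi>"
      then obtain \<Phi> where \<Phi>: "\<Phi> \<in> points" "f \<Phi> \<noteq> 0" "l (\<Phi> \<inter> S) \<in> \<Psi>"
        unfolding T_def by blast
      have lB: "l (\<Phi> \<inter> S) \<in> B" by (rule l(1)) blast
      show "f \<Psi> \<noteq> 0"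
        using nonvanishing_mono[OF f principal_in_points[OF lB] \<Psi> principal_least[OF \<Psi> \<Phi>(3)]]
          value_at_meet(2)[OF \<Phi>(1)] \<Phi>(2) by simp
    qed
  qed
qed

section \<open>The prime ideals of the ring of coherent functions\<close>

definition vanishing :: "'i set \<Rightarrow> ('i set \<Rightarrow> 'i ratfun) set"
  where "vanishing \<Phi> = {f \<in> coherent. f \<Phi> = 0}"

lemma primeideal_vanishing:
  assumes "\<Phi> \<in> points"
  shows "primeideal (vanishing \<Phi>) coherent_ring"
proof (rule primeidealI)
  show "ideal (vanishing \<Phi>) coherent_ring"
  proof (rule idealI[OF coh.ring_axioms])
    show "subgroup (vanishing \<Phi>) (add_monoid coherent_ring)"
    proof (rule coh.add.subgroupI)
      show "vanishing \<Phi> \<subseteq> carrier coherent_ring" by (auto simp: vanishing_def coherent_ring_def)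
      show "vanishing \<Phi> \<noteq> {}" using coherent_zero by (auto simp: vanishing_def)
    next
      fix f assume f: "f \<in> vanishing \<Phi>"
      then have fc: "f \<in> carrier coherent_ring" by (simp add: vanishing_def coherent_ring_def)
      have "(f \<oplus>\<^bsub>coherent_ring\<^esub> (\<ominus>\<^bsub>coherent_ring\<^esub> f)) \<Phi> = 0"
        using fc by (simp add: coh.r_neg coherent_ring_simps)
      then have "(\<ominus>\<^bsub>coherent_ring\<^esub> f) \<Phi> = 0" using f by (simp add: coherent_ring_simps vanishing_def)
      moreover have "\<ominus>\<^bsub>coherent_ring\<^esub> f \<in> carrier coherent_ring" using fc by (rule coh.a_inv_closed)
      ultimately show "\<ominus>\<^bsub>coherent_ring\<^esub> f \<in> vanishing \<Phi>" by (simp add: vanishing_def coherent_ring_simps)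
    next
      fix f g assume "f \<in> vanishing \<Phi>" "g \<in> vanishing \<Phi>"
      then show "f \<oplus>\<^bsub>coherent_ring\<^esub> g \<in> vanishing \<Phi>"
        by (simp add: vanishing_def coherent_ring_def coherent_add)
    qed
  qed (auto simp: vanishing_def coherent_ring_def coherent_mult)
  show "cring coherent_ring" by (rule coh.cring_axioms)
  have "\<one>\<^bsub>coherent_ring\<^esub> \<notin> vanishing \<Phi>"
    using assms by (simp add: vanishing_def coherent_ring_simps)
  then show "carrier coherent_ring \<noteq> vanishing \<Phi>"
    using coh.one_closed by blast
qed (auto simp: vanishing_def coherent_ring_def)


text \<open>
  The point of a prime \<open>Q\<close> is the set of those \<open>i\<close> whose coordinate function is not in \<open>Q\<close>. Membership of a
  function in \<open>Q\<close> depends only on its nonvanishing locus, by \<open>divides_power\<close>, and this makes the set a filter.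
  For a general \<open>f\<close>, whose nonvanishing locus is the union of the basic open sets of the \<open>i\<close> in a finite set \<open>T\<close>,
  the locus is also that of the sum of the coordinate functions over \<open>T\<close>: a sum of distinct
  indeterminates is never zero. Hence \<open>f\<close> is in \<open>Q\<close> exactly if all these coordinate functions are.
\<close>

lemma primeideal_is_vanishing:
  assumes "primeideal Q coherent_ring"
  obtains \<Phi> where "\<Phi> \<in> points" "Q = vanishing \<Phi>"
proof -
  interpret Q: primeideal Q coherent_ring by fact
  have Q_sub: "Q \<subseteq> coherent" using Q.a_subset by (simp add: coherent_ring_def)
  have pow_in: "f \<in> Q" if "f \<in> coherent" "f [^]\<^bsub>coherent_ring\<^esub> n \<in> Q" for f and n :: nat
    using that(2)
  proof (induction n)
    case 0
    then show ?case using Q.one_imp_carrier Q.I_notcarr by simp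
  next
    case (Suc n)
    then have "f [^]\<^bsub>coherent_ring\<^esub> n \<otimes>\<^bsub>coherent_ring\<^esub> f \<in> Q" by simp
    moreover have "f \<in> carrier coherent_ring" using that(1) by (simp add: coherent_ring_def)
    ultimately show ?case using Q.I_prime Suc.IH by blast
  qed
  have support_in: "g \<in> Q"
    if "f \<in> Q" "g \<in> coherent" "\<And>\<Phi>. \<Phi> \<in> points \<Longrightarrow> g \<Phi> \<noteq> 0 \<Longrightarrow> f \<Phi> \<noteq> 0" for f g
  proof -
    from that Q_sub obtain h and n :: nat
      where h: "h \<in> coherent" "g [^]\<^bsub>coherent_ring\<^esub> n = f \<otimes>\<^bsub>coherent_ring\<^esub> h"
      using divides_power[of f g] by blast
    then have "g [^]\<^bsub>coherent_ring\<^esub> n \<in> Q"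
      using Q.I_r_closed[OF that(1)] by (simp add: coherent_ring_simps(1))
    then show ?thesis by (rule pow_in[OF that(2)])
  qed
  define \<Phi> where "\<Phi> = {i \<in> B. coord i \<notin> Q}"
  have coord_mono: "coord j \<notin> Q"
    if "coord i \<notin> Q" "\<And>\<Psi>. \<Psi> \<in> points \<Longrightarrow> i \<in> \<Psi> \<Longrightarrow> j \<in> \<Psi>" for i j
  proof
    assume "coord j \<in> Q"
    then have "coord i \<in> Q"
      by (rule support_in[OF _ coord_coherent]) (simp add: coord_nonzero_iff that(2))
    then show False using that(1) by blast
  qed
  have "\<Phi> \<in> points"
    unfolding filters_def
  proof (intro CollectI conjI ballI impI)
    show "\<Phi> \<subseteq> B" by (auto simp: \<Phi>_def)
    obtain e where e: "e \<in> B" "\<forall>i\<in>B. i \<preceq> e" using ex_top by blast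
    have "e \<in> \<Psi>" if "\<Psi> \<in> points" for \<Psi>
      using that e unfolding filters_def by blast
    then have "coord e \<notin> Q"
      using support_in[of "coord e" "\<one>\<^bsub>coherent_ring\<^esub>"] coord_nonzero_iff coh.one_closed
        Q.one_imp_carrier Q.I_notcarr unfolding coherent_ring_simps(1) by blast
    then show "\<Phi> \<noteq> {}" using e by (auto simp: \<Phi>_def)
  next
    fix i j assume "i \<in> \<Phi>" "j \<in> B" "i \<preceq> j"
    then show "j \<in> \<Phi>"
      unfolding \<Phi>_def using coord_mono[of i j] filter_mono by blast
  next
    fix i j assume "i \<in> \<Phi>" "j \<in> \<Phi>"
    then have ij: "i \<in> B" "j \<in> B" "coord i \<notin> Q" "coord j \<notin> Q" by (auto simp: \<Phi>_def)
    then obtain k where k: "k \<in> B" "k \<preceq> i" "k \<preceq> j" "\<forall>l\<in>B. l \<preceq> i \<and> l \<preceq> j \<longrightarrow> l \<preceq> k"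
      using ex_meet by blast
    have "k \<in> \<Psi>" if "\<Psi> \<in> points" "i \<in> \<Psi>" "j \<in> \<Psi>" for \<Psi>
      using filter_directed[OF that] filter_subset[OF that(1)] filter_mono[OF that(1)] k by blast
    then have "coord k \<Psi> \<noteq> 0"
      if "\<Psi> \<in> points" "(coord i \<otimes>\<^bsub>coherent_ring\<^esub> coord j) \<Psi> \<noteq> 0" for \<Psi>
      using that by (auto simp: coherent_ring_simps coord_nonzero_iff)
    moreover have prod: "coord i \<otimes>\<^bsub>coherent_ring\<^esub> coord j \<in> coherent"
      using coherent_mult[OF coord_coherent coord_coherent] by (simp add: coherent_ring_def)
    moreover have "coord i \<otimes>\<^bsub>coherent_ring\<^esub> coord j \<notin> Q"
      using Q.I_prime[of "coord i" "coord j"] ij coord_coherent by (auto simp: coherent_ring_simps(1))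
    ultimately have "coord k \<notin> Q" using support_in by blast
    then show "\<exists>k\<in>\<Phi>. k \<preceq> i \<and> k \<preceq> j" using k by (auto simp: \<Phi>_def)
  qed
  moreover have "f \<in> Q \<longleftrightarrow> f \<Phi> = 0" if f: "f \<in> coherent" for f
  proof -
    obtain T where T: "finite T" "T \<subseteq> B"
      "\<forall>\<Psi>\<in>points. f \<Psi> \<noteq> 0 \<longleftrightarrow> (\<exists>i\<in>T. i \<in> \<Psi>)"
      by (rule support_finite_union[OF f])
    show ?thesis
    proof
      assume "f \<in> Q"
      have "i \<notin> \<Phi>" if "i \<in> T" for i
        using support_in[OF \<open>f \<in> Q\<close> coord_coherent[of i]] coord_nonzero_iff T(3) that
        by (auto simp: \<Phi>_def)
      then show "f \<Phi> = 0" using T(3)[rule_format, OF \<open>\<Phi> \<in> points\<close>] by blast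
    next
      assume "f \<Phi> = 0"
      then have TQ: "coord i \<in> Q" if "i \<in> T" for i
        using T(2,3) \<open>\<Phi> \<in> points\<close> that by (auto simp: \<Phi>_def)
      define s where "s \<Psi> = (\<Sum>i\<in>T. coord i \<Psi>)" for \<Psi>
      have "(\<lambda>\<Psi>. \<Sum>i\<in>U. coord i \<Psi>) \<in> Q" if "U \<subseteq> T" for U
        using finite_subset[OF that T(1)] that
      proof (induction U rule: finite_induct)
        case empty
        have "\<zero>\<^bsub>coherent_ring\<^esub> \<in> Q" by simp
        then show ?case by (simp add: coherent_ring_def)
      next
        case (insert i U)
        then have "coord i \<oplus>\<^bsub>coherent_ring\<^esub> (\<lambda>\<Psi>. \<Sum>i\<in>U. coord i \<Psi>) \<in> Q"
          using TQ by (intro Q.a_closed) auto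
        then show ?case using insert by (simp add: coherent_ring_def)
      qed
      then have "s \<in> Q" unfolding s_def by blast
      moreover have "s \<Psi> \<noteq> 0" if "\<Psi> \<in> points" "f \<Psi> \<noteq> 0" for \<Psi>
      proof -
        have "s \<Psi> = (\<Sum>i\<in>{i\<in>T. i \<in> \<Psi>}. indet i)"
          using T(1) that(1) by (simp add: s_def coord_def sum.inter_filter)
        moreover have "{i\<in>T. i \<in> \<Psi>} \<noteq> {}" using T(3) that by blast
        ultimately show ?thesis using T(1) by (simp add: sum_indets_nonzero)
      qed
      ultimately show "f \<in> Q" by (rule support_in[OF _ f])
    qed
  qed
  then have "Q = vanishing \<Phi>" unfolding vanishing_def using Q_sub by blast
  ultimately show thesis by (rule that)
qed

lemma bij_betw_vanishing: "bij_betw vanishing points (prime_spectrum coherent_ring)"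
proof (rule bij_betwI')
  fix \<Phi> \<Psi> assume \<Phi>\<Psi>: "\<Phi> \<in> points" "\<Psi> \<in> points"
  show "vanishing \<Phi> = vanishing \<Psi> \<longleftrightarrow> \<Phi> = \<Psi>"
  proof
    assume "vanishing \<Phi> = vanishing \<Psi>"
    then have "coord i \<Phi> = 0 \<longleftrightarrow> coord i \<Psi> = 0" for i
      using coord_coherent[of i] unfolding vanishing_def by blast
    then show "\<Phi> = \<Psi>" using coord_nonzero_iff \<Phi>\<Psi> by blast
  qed simp
next
  show "vanishing \<Phi> \<in> prime_spectrum coherent_ring" if "\<Phi> \<in> points" for \<Phi>
    using primeideal_vanishing[OF that] by (simp add: prime_spectrum_def)
next
  show "\<exists>\<Phi>\<in>points. Q = vanishing \<Phi>" if "Q \<in> prime_spectrum coherent_ring" for Q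
    using primeideal_is_vanishing[of Q] that unfolding prime_spectrum_def by blast
qed

text \<open>
  Evaluation kernels give the bijection with the primes. The map \<open>e\<close> only serves to move the ring
  to the carrier type that the definition of a spectral space prescribes.
\<close>

theorem spectral_space_filter_topology: "spectral_space (filter_topology B below)"
proof -
  let ?X = "filter_topology B below"
  obtain e :: "('i set \<Rightarrow> 'i ratfun) \<Rightarrow> ('i set + nat) set" where e: "inj e"
    using ex_inj_ratfun_functions by blast
  let ?R = "image_ring e coherent_ring"
  have e_on: "inj_on e (carrier coherent_ring)" using e by (rule inj_on_subset) simp
  have in_image: "e f \<in> e ` vanishing \<Phi> \<longleftrightarrow> f \<Phi> = 0" if "f \<in> coherent" for f \<Phi>
    using e that by (auto simp: vanishing_def inj_eq)
  have "cring ?R"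
    using coh.ring_iso_imp_img_cring[OF inj_imp_image_ring_iso[OF e_on]]
    by (simp add: image_ring_def image_group_def monoid.defs)
  moreover have "?X homeomorphic_space prime_spectrum_topology ?R"
  proof (rule homeomorphic_prime_spectrumI[where \<pi> = "\<lambda>\<Phi>. e ` vanishing \<Phi>"])
    have "bij_betw ((`) e) (prime_spectrum coherent_ring) (prime_spectrum ?R)"
      unfolding prime_spectrum_image_ring[OF coh.cring_axioms e_on]
      by (rule inj_on_imp_bij_betw) (use e in \<open>auto intro!: inj_onI simp: inj_image_eq_iff\<close>)
    from bij_betw_trans[OF bij_betw_vanishing this]
    show "bij_betw (\<lambda>\<Phi>. e ` vanishing \<Phi>) (topspace ?X) (prime_spectrum ?R)"
      by (simp add: topspace_filter_topology comp_def)
  next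
    fix g assume "g \<in> carrier ?R"
    then obtain f where f: "f \<in> coherent" "g = e f"
      by (auto simp: image_ring_carrier coherent_ring_simps(1))
    obtain T where T: "finite T" "T \<subseteq> B"
      "\<forall>\<Psi>\<in>points. f \<Psi> \<noteq> 0 \<longleftrightarrow> (\<exists>i\<in>T. i \<in> \<Psi>)"
      by (rule support_finite_union[OF f(1)])
    have "{\<Phi> \<in> topspace ?X. g \<notin> e ` vanishing \<Phi>} = (\<Union>i\<in>T. {\<Phi> \<in> points. i \<in> \<Phi>})"
      using T(3) by (auto simp: f in_image topspace_filter_topology)
    also have "openin ?X \<dots>"
      using T(2) unfolding filter_topology_def
      by (intro openin_Union ballI; clarify; intro topology_generated_by_Basis) blast
    finally show "openin ?X {\<Phi> \<in> topspace ?X. g \<notin> e ` vanishing \<Phi>}" .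
  next
    show "?X = topology_generated_by {{\<Phi> \<in> points. i \<in> \<Phi>} | i. i \<in> B}"
      by (rule filter_topology_def)
    fix U assume "U \<in> {{\<Phi> \<in> points. i \<in> \<Phi>} | i. i \<in> B}"
    then obtain i where U: "U = {\<Phi> \<in> points. i \<in> \<Phi>}" by blast
    have "U = {\<Phi> \<in> topspace ?X. e (coord i) \<notin> e ` vanishing \<Phi>}"
      using coord_nonzero_iff by (auto simp: U in_image coord_coherent topspace_filter_topology)
    moreover have "e (coord i) \<in> carrier ?R"
      using coord_coherent by (simp add: image_ring_carrier coherent_ring_simps(1))
    ultimately show "\<exists>f\<in>carrier ?R. U = {\<Phi> \<in> topspace ?X. f \<notin> e ` vanishing \<Phi>}" by blast
  qed
  ultimately show ?thesis unfolding spectral_space_def by blast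
qed

end

section \<open>Localizing systems as filters of finitely generated ideals\<close>

lemma spectral_space_homeomorphic:
  fixes X Y :: "'p topology"
  assumes "X homeomorphic_space Y" "spectral_space Y"
  shows "spectral_space X"
  using assms unfolding spectral_space_def by (metis homeomorphic_space_trans)

context cring
begin

lemma ideal_ideal_colon:
  assumes "ideal K R" "a \<in> carrier R"
  shows "ideal (ideal_colon R K a) R"
proof -
  interpret K: ideal K R by fact
  show ?thesis
  proof (rule idealI[OF ring_axioms])
    show "subgroup (ideal_colon R K a) (add_monoid R)"
    proof (rule add.subgroupI)
      show "ideal_colon R K a \<subseteq> carrier R" by (auto simp: ideal_colon_def)
      have "\<zero> \<in> ideal_colon R K a" using assms(2) by (simp add: ideal_colon_def)
      then show "ideal_colon R K a \<noteq> {}" by blast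
    next
      fix d e assume "d \<in> ideal_colon R K a" "e \<in> ideal_colon R K a"
      then show "\<ominus> d \<in> ideal_colon R K a" "d \<oplus> e \<in> ideal_colon R K a"
        using assms(2) by (simp_all add: ideal_colon_def l_minus l_distr)
    qed
  next
    fix d x assume d: "d \<in> ideal_colon R K a" and x: "x \<in> carrier R"
    then have "x \<otimes> (d \<otimes> a) \<in> K" by (auto simp: ideal_colon_def intro: K.I_l_closed)
    then show "x \<otimes> d \<in> ideal_colon R K a" "d \<otimes> x \<in> ideal_colon R K a"
      using d x assms(2) by (auto simp: ideal_colon_def m_ac)
  qed
qed

text \<open>
  The elements that multiply a given element into \<open>K\<close> form an ideal, so the condition passes from
  generators to ideals, one factor at a time.
\<close>

lemma genideal_mult_subset:
  assumes "S \<subseteq> carrier R" "T \<subseteq> carrier R" "ideal K R" "\<And>s t. s \<in> S \<Longrightarrow> t \<in> T \<Longrightarrow> s \<otimes> t \<in> K"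
    and "i \<in> Idl S" "j \<in> Idl T"
  shows "i \<otimes> j \<in> K"
proof -
  have i: "i \<in> carrier R" using ideal.Icarr[OF genideal_ideal] assms by blast
  have "t \<otimes> i \<in> K" if "t \<in> T" for t
  proof -
    have "S \<subseteq> ideal_colon R K t" using assms that by (auto simp: ideal_colon_def)
    then have "i \<in> ideal_colon R K t"
      using genideal_minimal[OF ideal_ideal_colon] assms that by blast
    then show ?thesis using assms(2) that i by (auto simp: ideal_colon_def m_comm)
  qed
  then have "T \<subseteq> ideal_colon R K i" using assms by (auto simp: ideal_colon_def)
  then have "j \<in> ideal_colon R K i"
    using genideal_minimal[OF ideal_ideal_colon] assms i by blast
  then show ?thesis using i by (auto simp: ideal_colon_def m_comm)
qed

end

definition fg_ideals :: "('a, 'm) ring_scheme \<Rightarrow> 'a set set"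
  where "fg_ideals D = {I. fin_gen_ideal D I \<and> I \<noteq> {\<zero>\<^bsub>D\<^esub>}}"

text \<open>
  The inclusion of the basic open sets given by \<open>I\<close> and \<open>J\<close>. For nonzero finitely generated ideals this
  amounts to \<open>I\<^sup>n \<subseteq> J\<close> for some \<open>n\<close>. Defining it through the localizing systems makes it
  immediate that their traces on the finitely generated ideals are upward closed.
\<close>

definition forces :: "('a, 'm) ring_scheme \<Rightarrow> 'a set \<Rightarrow> 'a set \<Rightarrow> bool"
  where "forces D I J \<longleftrightarrow> (\<forall>\<F>\<in>LS_f D. I \<in> \<F> \<longrightarrow> J \<in> \<F>)"

text \<open>
  A localizing system of finite type is recovered from its finitely generated members by taking
  all larger ideals.
\<close>

definition generated_system :: "('a, 'm) ring_scheme \<Rightarrow> 'a set set \<Rightarrow> 'a set set"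
  where "generated_system D \<Phi> = {J. ideal J D \<and> (\<exists>I\<in>\<Phi>. I \<subseteq> J)}"

context domain
begin

lemma fg_idealsD:
  assumes "I \<in> fg_ideals R"
  shows "ideal I R" "I \<noteq> {\<zero>}" "fin_gen_ideal R I"
  using assms genideal_ideal by (auto simp: fg_ideals_def fin_gen_ideal_def)

lemma carrier_in_fg_ideals: "carrier R \<in> fg_ideals R"
proof -
  have "carrier R \<noteq> {\<zero>}" using one_closed one_not_zero by blast
  moreover have "fin_gen_ideal R (carrier R)"
    unfolding fin_gen_ideal_def by (rule exI[of _ "{\<one>}"]) (simp add: genideal_one)
  ultimately show ?thesis by (simp add: fg_ideals_def)
qed

lemma LS_fD:
  assumes "\<F> \<in> LS_f R"
  shows "\<F> \<noteq> {}"
    and "I \<in> \<F> \<Longrightarrow> ideal I R"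
    and "I \<in> \<F> \<Longrightarrow> ideal J R \<Longrightarrow> I \<subseteq> J \<Longrightarrow> J \<in> \<F>"
    and "I \<in> \<F> \<Longrightarrow> ideal J R \<Longrightarrow> (\<And>i. i \<in> I \<Longrightarrow> ideal_colon R J i \<in> \<F>) \<Longrightarrow> J \<in> \<F>"
    and "I \<in> \<F> \<Longrightarrow> \<exists>J\<in>\<F>. J \<in> fg_ideals R \<and> J \<subseteq> I"
proof -
  have *: "localizing_system R \<F>" "finite_type R \<F>"
    using assms by (auto simp: LS_f_def LS_def)
  note system = *(1)[unfolded localizing_system_def]
  note nonempty = system[THEN conjunct1]
    and ideals = system[THEN conjunct2, THEN conjunct1]
    and up = system[THEN conjunct2, THEN conjunct2, THEN conjunct1]
    and local = system[THEN conjunct2, THEN conjunct2, THEN conjunct2]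
  show "\<F> \<noteq> {}" by (rule nonempty)
  show "I \<in> \<F> \<Longrightarrow> ideal I R" using ideals by blast
  show "I \<in> \<F> \<Longrightarrow> ideal J R \<Longrightarrow> I \<subseteq> J \<Longrightarrow> J \<in> \<F>" using up by blast
  show "I \<in> \<F> \<Longrightarrow> ideal J R \<Longrightarrow> (\<And>i. i \<in> I \<Longrightarrow> ideal_colon R J i \<in> \<F>) \<Longrightarrow> J \<in> \<F>"
    by (rule local[rule_format]) (intro conjI ballI)
  show "I \<in> \<F> \<Longrightarrow> \<exists>J\<in>\<F>. J \<in> fg_ideals R \<and> J \<subseteq> I"
    using *(2) unfolding finite_type_def fg_ideals_def by blast
qed

text \<open>
  Closure under products follows from the second axiom: for \<open>i \<in> I\<close>, the ideal \<open>(K : i)\<close> contains \<open>J\<close>.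
\<close>

lemma LS_f_mult:
  assumes F: "\<F> \<in> LS_f R" and "I \<in> \<F>" "J \<in> \<F>" "ideal K R"
    and "\<And>i j. i \<in> I \<Longrightarrow> j \<in> J \<Longrightarrow> i \<otimes> j \<in> K"
  shows "K \<in> \<F>"
proof (rule LS_fD(4)[OF F \<open>I \<in> \<F>\<close> \<open>ideal K R\<close>])
  fix i assume i: "i \<in> I"
  have carr: "I \<subseteq> carrier R" "J \<subseteq> carrier R"
    using ideal.Icarr[OF LS_fD(2)[OF F assms(2)]] ideal.Icarr[OF LS_fD(2)[OF F assms(3)]] by auto
  have "J \<subseteq> ideal_colon R K i"
  proof
    fix j assume j: "j \<in> J"
    then have "j \<otimes> i = i \<otimes> j" using carr i by (intro m_comm) auto
    then show "j \<in> ideal_colon R K i"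
      using assms(5)[OF i j] carr j by (auto simp: ideal_colon_def)
  qed
  moreover have "ideal (ideal_colon R K i) R"
    using ideal_ideal_colon[OF assms(4)] carr i by blast
  ultimately show "ideal_colon R K i \<in> \<F>"
    using LS_fD(3)[OF F \<open>J \<in> \<F>\<close>] by blast
qed

text \<open>
  The ideal product of \<open>I\<close> and \<open>J\<close>, characterized as the least ideal containing all products. It is
  nonzero because the ring is a domain, and it is generated by the products of generators.
\<close>

lemma ex_fg_product:
  assumes "I \<in> fg_ideals R" "J \<in> fg_ideals R"
  shows "\<exists>K\<in>fg_ideals R. K \<subseteq> I \<and> K \<subseteq> J \<and> (\<forall>i\<in>I. \<forall>j\<in>J. i \<otimes> j \<in> K) \<and>
    (\<forall>N. ideal N R \<and> (\<forall>i\<in>I. \<forall>j\<in>J. i \<otimes> j \<in> N) \<longrightarrow> K \<subseteq> N)"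
proof -
  obtain S T where S: "finite S" "S \<subseteq> carrier R" "I = Idl S"
    and T: "finite T" "T \<subseteq> carrier R" "J = Idl T"
    using fg_idealsD(3)[OF assms(1)] fg_idealsD(3)[OF assms(2)] unfolding fin_gen_ideal_def by blast
  define U where "U = (\<lambda>(s, t). s \<otimes> t) ` (S \<times> T)"
  have U: "finite U" "U \<subseteq> carrier R" unfolding U_def using S T by auto
  interpret I: ideal I R by (rule fg_idealsD[OF assms(1)])
  interpret J: ideal J R by (rule fg_idealsD[OF assms(2)])
  have sub: "S \<subseteq> I" "T \<subseteq> J" using S T genideal_self by auto
  have mult: "\<forall>i\<in>I. \<forall>j\<in>J. i \<otimes> j \<in> Idl U"
  proof (intro ballI)
    fix i j assume "i \<in> I" "j \<in> J"
    then show "i \<otimes> j \<in> Idl U"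
      using genideal_mult_subset[OF S(2) T(2) genideal_ideal[OF U(2)]] genideal_self[OF U(2)] S(3) T(3)
      by (force simp: U_def)
  qed
  have minimal: "Idl U \<subseteq> N" if "ideal N R" "\<forall>i\<in>I. \<forall>j\<in>J. i \<otimes> j \<in> N" for N
    by (rule genideal_minimal[OF that(1)]) (use that(2) sub in \<open>auto simp: U_def\<close>)
  obtain i j where "i \<in> I" "i \<noteq> \<zero>" "j \<in> J" "j \<noteq> \<zero>"
    using fg_idealsD(2)[OF assms(1)] fg_idealsD(2)[OF assms(2)] I.zero_closed J.zero_closed by blast
  then have "i \<otimes> j \<in> Idl U" "i \<otimes> j \<noteq> \<zero>"
    using mult integral I.Icarr J.Icarr by blast+
  then have "Idl U \<in> fg_ideals R"
    using U unfolding fg_ideals_def fin_gen_ideal_def by blast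
  moreover have "Idl U \<subseteq> I"
    by (rule minimal[OF I.is_ideal]) (auto intro: I.I_r_closed)
  moreover have "Idl U \<subseteq> J"
    by (rule minimal[OF J.is_ideal]) (auto intro: J.I_l_closed)
  ultimately show ?thesis
    by (intro bexI[of _ "Idl U"] conjI allI impI) (use mult minimal in auto)
qed

lemma forces_if_subset: "I \<subseteq> J \<Longrightarrow> ideal J R \<Longrightarrow> forces R I J"
  unfolding forces_def using LS_fD(3) by blast

lemma forces_product:
  assumes "forces R L I" "forces R L J" "ideal K R" "\<forall>i\<in>I. \<forall>j\<in>J. i \<otimes> j \<in> K"
  shows "forces R L K"
  unfolding forces_def
proof (intro ballI impI)
  fix \<F> assume "\<F> \<in> LS_f R" "L \<in> \<F>"
  then show "K \<in> \<F>" using assms LS_f_mult[of \<F> I J K] by (simp add: forces_def)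
qed

lemma meet_preorder_fg_ideals: "meet_preorder (fg_ideals R) (forces R)"
proof
  show "\<exists>e\<in>fg_ideals R. \<forall>I\<in>fg_ideals R. forces R I e"
    using carrier_in_fg_ideals forces_if_subset fg_idealsD(1) ideal.Icarr oneideal by (meson subsetI)
next
  fix I J assume IJ: "I \<in> fg_ideals R" "J \<in> fg_ideals R"
  from ex_fg_product[OF IJ] obtain K where K: "K \<in> fg_ideals R" "K \<subseteq> I" "K \<subseteq> J"
    "\<forall>i\<in>I. \<forall>j\<in>J. i \<otimes> j \<in> K"
    by blast
  show "\<exists>K\<in>fg_ideals R. forces R K I \<and> forces R K J \<and>
      (\<forall>L\<in>fg_ideals R. forces R L I \<and> forces R L J \<longrightarrow> forces R L K)"
  proof (intro bexI[OF _ K(1)] conjI ballI impI)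
    show "forces R K I" "forces R K J"
      using K IJ by (auto intro: forces_if_subset fg_idealsD)
    show "forces R L K" if "forces R L I \<and> forces R L J" for L
      using that by (intro forces_product[OF _ _ fg_idealsD(1)[OF K(1)] K(4)]) auto
  qed
qed (auto simp: forces_def)

interpretation fg: meet_preorder "fg_ideals R" "forces R"
  by (rule meet_preorder_fg_ideals)

text \<open>
  Directedness with respect to \<open>forces\<close> does not give common lower bounds with respect to
  inclusion. Products do.
\<close>

lemma filter_product:
  assumes \<Phi>: "\<Phi> \<in> filters (fg_ideals R) (forces R)" and "I \<in> \<Phi>" "J \<in> \<Phi>"
    and K: "K \<in> fg_ideals R" "\<forall>i\<in>I. \<forall>j\<in>J. i \<otimes> j \<in> K"
  shows "K \<in> \<Phi>"
proof -
  obtain L where L: "L \<in> \<Phi>" "forces R L I" "forces R L J"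
    using fg.filter_directed[OF assms(1-3)] by blast
  from L(2,3) have "forces R L K" by (rule forces_product[OF _ _ fg_idealsD(1)[OF K(1)] K(2)])
  then show ?thesis using fg.filter_mono[OF \<Phi> L(1) K(1)] by blast
qed

lemma filter_finite_lower_bound:
  assumes \<Phi>: "\<Phi> \<in> filters (fg_ideals R) (forces R)" and "finite A" "\<forall>a\<in>A. f a \<in> \<Phi>"
  shows "\<exists>K\<in>\<Phi>. \<forall>a\<in>A. K \<subseteq> f a"
  using assms(2,3)
proof (induction A rule: finite_induct)
  case empty
  then show ?case using \<Phi> by (auto simp: filters_def)
next
  case (insert a A)
  then obtain K where K: "K \<in> \<Phi>" "\<forall>a\<in>A. K \<subseteq> f a" by blast
  have "f a \<in> \<Phi>" using insert by blast
  then have "f a \<in> fg_ideals R" "K \<in> fg_ideals R" using K fg.filter_subset[OF \<Phi>] by blast+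
  then obtain L where L: "L \<in> fg_ideals R" "L \<subseteq> f a" "L \<subseteq> K" "\<forall>i\<in>f a. \<forall>j\<in>K. i \<otimes> j \<in> L"
    using ex_fg_product[of "f a" K] by blast
  then have "L \<in> \<Phi>" using filter_product[OF \<Phi> \<open>f a \<in> \<Phi>\<close> K(1)] by blast
  moreover have "\<forall>b\<in>insert a A. L \<subseteq> f b" using L(2,3) K(2) by blast
  ultimately show ?case by blast
qed

text \<open>
  For the second axiom, let \<open>I0\<close> be a member of the filter that is contained in the given ideal \<open>I\<close>. Each of its finitely many
  generators \<open>s\<close> has a member of the filter inside \<open>(J : s)\<close>. A common lower bound \<open>K\<close> of these
  members satisfies \<open>I0 K \<subseteq> J\<close>, and the product of \<open>I0\<close> and \<open>K\<close> is again in the filter.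
\<close>

lemma generated_system_in_LS_f:
  assumes \<Phi>: "\<Phi> \<in> filters (fg_ideals R) (forces R)"
  shows "generated_system R \<Phi> \<in> LS_f R"
proof -
  let ?F = "generated_system R \<Phi>"
  note sub = fg.filter_subset[OF \<Phi>]
  have gen: "I \<in> ?F" if "I \<in> \<Phi>" for I
    using that sub fg_idealsD(1) unfolding generated_system_def by blast
  have "\<Phi> \<noteq> {}" using \<Phi> by (simp add: filters_def)
  then have nonempty: "?F \<noteq> {}" using gen by blast
  have nonzero: "ideal J R \<and> J \<noteq> {\<zero>}" if J_in: "J \<in> ?F" for J
  proof -
    obtain I where I: "I \<in> \<Phi>" "I \<subseteq> J" and J: "ideal J R"
      using J_in unfolding generated_system_def by blast
    have "ideal I R" "I \<noteq> {\<zero>}" using I sub fg_idealsD by blast+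
    then have "\<zero> \<in> I" "I \<noteq> {\<zero>}" using additive_subgroup.zero_closed ideal.axioms(1) by blast+
    then show ?thesis using I J by blast
  qed
  have up: "J \<in> ?F" if "I \<in> ?F" "ideal J R" "I \<subseteq> J" for I J
    using that unfolding generated_system_def by blast
  have local: "J \<in> ?F" if I_in: "I \<in> ?F" and J: "ideal J R" and colon: "\<forall>i\<in>I. ideal_colon R J i \<in> ?F" for I J
  proof -
    obtain I0 where I0: "I0 \<in> \<Phi>" "I0 \<subseteq> I" using I_in unfolding generated_system_def by blast
    then have I0fg: "I0 \<in> fg_ideals R" using sub by blast
    obtain S where S: "finite S" "S \<subseteq> carrier R" "I0 = Idl S"
      using fg_idealsD(3)[OF I0fg] unfolding fin_gen_ideal_def by blast
    have "S \<subseteq> I" using genideal_self[OF S(2)] S(3) I0 by blast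
    then have "\<forall>s\<in>S. \<exists>L\<in>\<Phi>. L \<subseteq> ideal_colon R J s"
      using colon unfolding generated_system_def by blast
    then obtain f where f: "\<forall>s\<in>S. f s \<in> \<Phi> \<and> f s \<subseteq> ideal_colon R J s" by metis
    then obtain K where K: "K \<in> \<Phi>" "\<forall>s\<in>S. K \<subseteq> f s"
      using filter_finite_lower_bound[OF \<Phi> S(1), of f] by blast
    then have Kfg: "K \<in> fg_ideals R" using sub by blast
    have "i \<otimes> k \<in> J" if "i \<in> I0" "k \<in> K" for i k
    proof -
      have k: "k \<in> carrier R" by (rule ideal.Icarr[OF fg_idealsD(1)[OF Kfg] that(2)])
      have "S \<subseteq> ideal_colon R J k"
      proof
        fix s assume "s \<in> S"
        then have "k \<in> ideal_colon R J s" using K f that by blast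
        moreover have "k \<otimes> s = s \<otimes> k" using \<open>s \<in> S\<close> S(2) k by (intro m_comm) auto
        ultimately show "s \<in> ideal_colon R J k"
          using \<open>s \<in> S\<close> S(2) by (auto simp: ideal_colon_def)
      qed
      then have "I0 \<subseteq> ideal_colon R J k"
        unfolding S(3) by (rule genideal_minimal[OF ideal_ideal_colon[OF J k]])
      then show ?thesis using that by (auto simp: ideal_colon_def)
    qed
    moreover obtain L where L: "L \<in> fg_ideals R" "\<forall>i\<in>I0. \<forall>k\<in>K. i \<otimes> k \<in> L"
      "\<forall>N. ideal N R \<and> (\<forall>i\<in>I0. \<forall>k\<in>K. i \<otimes> k \<in> N) \<longrightarrow> L \<subseteq> N"
      using ex_fg_product[OF I0fg Kfg] by blast
    ultimately have "L \<subseteq> J" using J by blast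
    moreover have "L \<in> \<Phi>" by (rule filter_product[OF \<Phi> I0(1) K(1) L(1,2)])
    ultimately show ?thesis using J unfolding generated_system_def by blast
  qed
  have "finite_type R ?F"
    unfolding finite_type_def
  proof
    fix J assume "J \<in> ?F"
    then obtain I where I: "I \<in> \<Phi>" "I \<subseteq> J" unfolding generated_system_def by blast
    then have "I \<in> fg_ideals R" using sub by blast
    then show "\<exists>I\<in>?F. fin_gen_ideal R I \<and> I \<noteq> {\<zero>} \<and> I \<subseteq> J"
      using gen[OF I(1)] I(2) fg_idealsD(2,3) by blast
  qed
  moreover have "localizing_system R ?F"
    unfolding localizing_system_def using nonempty nonzero up local by blast
  ultimately show ?thesis by (simp add: LS_f_def LS_def)
qed

lemma LS_f_restrict_in_filters:
  assumes F: "\<F> \<in> LS_f R"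
  shows "\<F> \<inter> fg_ideals R \<in> filters (fg_ideals R) (forces R)"
  unfolding filters_def
proof (intro CollectI conjI ballI impI)
  show "\<F> \<inter> fg_ideals R \<noteq> {}" using LS_fD(1,5)[OF F] by blast
next
  fix I J assume "I \<in> \<F> \<inter> fg_ideals R" "J \<in> fg_ideals R" "forces R I J"
  then show "J \<in> \<F> \<inter> fg_ideals R" using F by (auto simp: forces_def)
next
  fix I J assume IJ: "I \<in> \<F> \<inter> fg_ideals R" "J \<in> \<F> \<inter> fg_ideals R"
  then obtain K where K: "K \<in> fg_ideals R" "K \<subseteq> I" "K \<subseteq> J" "\<forall>i\<in>I. \<forall>j\<in>J. i \<otimes> j \<in> K"
    using ex_fg_product[of I J] by blast
  then have "K \<in> \<F>" using LS_f_mult[OF F, of I J K] IJ fg_idealsD(1) by blast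
  then show "\<exists>K\<in>\<F> \<inter> fg_ideals R. forces R K I \<and> forces R K J"
    using K IJ forces_if_subset fg_idealsD(1) by blast
qed simp

lemma generated_system_restrict:
  assumes F: "\<F> \<in> LS_f R"
  shows "generated_system R (\<F> \<inter> fg_ideals R) = \<F>"
  unfolding generated_system_def using LS_fD(2,3,5)[OF F] by blast

lemma restrict_generated_system:
  assumes \<Phi>: "\<Phi> \<in> filters (fg_ideals R) (forces R)"
  shows "generated_system R \<Phi> \<inter> fg_ideals R = \<Phi>"
  unfolding generated_system_def
  using fg.filter_subset[OF \<Phi>] fg.filter_mono[OF \<Phi>] fg_idealsD(1) forces_if_subset by blast

lemma LS_f_homeomorphic_filters:
  "subtopology (LS_zariski R) (LS_f R) homeomorphic_space filter_topology (fg_ideals R) (forces R)"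
proof -
  let ?X = "subtopology (LS_zariski R) (LS_f R)"
  let ?Y = "filter_topology (fg_ideals R) (forces R)"
  have X: "topspace ?X = LS_f R"
    by (auto simp: topspace_LS_zariski LS_f_def)
  have Y: "topspace ?Y = filters (fg_ideals R) (forces R)" by (rule topspace_filter_topology)
  have "continuous_map ?X ?Y (\<lambda>\<F>. \<F> \<inter> fg_ideals R)"
    unfolding filter_topology_def
  proof (rule continuous_on_generated_topo)
    fix U assume "U \<in> {{\<Phi> \<in> filters (fg_ideals R) (forces R). I \<in> \<Phi>} | I. I \<in> fg_ideals R}"
    then obtain I where I: "I \<in> fg_ideals R" "U = {\<Phi> \<in> filters (fg_ideals R) (forces R). I \<in> \<Phi>}"
      by blast
    have "(\<lambda>\<F>. \<F> \<inter> fg_ideals R) -` U \<inter> topspace ?X = {\<F> \<in> LS R. I \<in> \<F>} \<inter> LS_f R"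
      unfolding X I(2) using I(1) LS_f_restrict_in_filters by (auto simp: LS_f_def)
    moreover have "openin (LS_zariski R) {\<F> \<in> LS R. I \<in> \<F>}"
      unfolding LS_zariski_def by (rule topology_generated_by_Basis) (use fg_idealsD(1)[OF I(1)] in blast)
    ultimately show "openin ?X ((\<lambda>\<F>. \<F> \<inter> fg_ideals R) -` U \<inter> topspace ?X)"
      by (auto simp: openin_subtopology)
  next
    show "(\<lambda>\<F>. \<F> \<inter> fg_ideals R) ` topspace ?X \<subseteq>
        \<Union>{{\<Phi> \<in> filters (fg_ideals R) (forces R). I \<in> \<Phi>} | I. I \<in> fg_ideals R}"
      using LS_f_restrict_in_filters Y unfolding X
      by (auto simp: filter_topology_def topology_generated_by_topspace)
  qed
  moreover have "continuous_map ?Y (LS_zariski R) (generated_system R)"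
    unfolding LS_zariski_def
  proof (rule continuous_on_generated_topo)
    fix U assume "U \<in> {{\<F> \<in> LS R. J \<in> \<F>} | J. ideal J R}"
    then obtain J where J: "ideal J R" "U = {\<F> \<in> LS R. J \<in> \<F>}" by blast
    have "generated_system R -` U \<inter> topspace ?Y =
        (\<Union>I\<in>{I \<in> fg_ideals R. I \<subseteq> J}. {\<Phi> \<in> filters (fg_ideals R) (forces R). I \<in> \<Phi>})"
    proof -
      have "generated_system R \<Phi> \<in> LS R" if "\<Phi> \<in> topspace ?Y" for \<Phi>
        using generated_system_in_LS_f that unfolding Y LS_f_def by blast
      then show ?thesis
        unfolding J(2) using J(1) fg.filter_subset unfolding Y generated_system_def by blast
    qed
    also have "openin ?Y \<dots>"
      unfolding filter_topology_def
      by (intro openin_Union ballI; clarify; intro topology_generated_by_Basis) blast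
    finally show "openin ?Y (generated_system R -` U \<inter> topspace ?Y)" .
  next
    have "generated_system R ` topspace ?Y \<subseteq> topspace (LS_zariski R)"
      using generated_system_in_LS_f unfolding Y topspace_LS_zariski LS_f_def by blast
    then show "generated_system R ` topspace ?Y \<subseteq> \<Union>{{\<F> \<in> LS R. J \<in> \<F>} | J. ideal J R}"
      by (simp add: LS_zariski_def topology_generated_by_topspace)
  qed
  then have "continuous_map ?Y ?X (generated_system R)"
    by (rule continuous_map_into_subtopology) (use generated_system_in_LS_f Y in auto)
  ultimately show ?thesis
    unfolding homeomorphic_space_def homeomorphic_maps_def X Y
    using generated_system_restrict restrict_generated_system by blast
qed

end

theorem corollary4p8:
  fixes D :: "('a, 'm) ring_scheme"
  assumes "domain D"
  shows "spectral_space (subtopology (LS_zariski D) (LS_f D))"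
proof -
  interpret domain D by fact
  interpret fg: meet_preorder "fg_ideals D" "forces D" by (rule meet_preorder_fg_ideals)
  show ?thesis
    by (rule spectral_space_homeomorphic[OF LS_f_homeomorphic_filters fg.spectral_space_filter_topology])
qed

end
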